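(* Let $R$ be a ring and let $G$ be a locally finite $p$-group, where $p$ is a prime. Then the group ring $RG$ is GUNC if and only if $R$ is GUNC and $p\in\mathrm{Nil}(R)$.
   Context: Rings are associative with identity, not necessarily commutative. $RG$ is the group ring of $G$ over $R$. $\mathrm{Nil}(R)$ is the set of nilpotent elements of $R$; $p\in \mathrm{Nil}(R)$ means that $p\cdot 1_R$ is nilpotent. A group is a $p$-group ($p$ a prime) if the order of every element is a power of $p$; it is locally finite if every finitely generated subgroup is finite. An element $a$ of a ring is uniquely nil-clean if there is a unique idempotent $e$ of the ring such that $a-e$ is nilpotent. A ring is generalized uniquely nil-clean (GUNC) if every non-invertible element is uniquely nil-clean.
   Formalization: The group G is additionally assumed nontrivial; for the trivial group the claim fails, e.g. R = ℚ, where RG ≅ ℚ is GUNC but p is not nilpotent in ℚ. *)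

theory Defs
  imports "HOL-Algebra.Algebra"
begin

text \<open>
  Elements of the group ring are the finitely supported functions from \<open>carrier G\<close> to \<open>carrier R\<close>,
  encoded as total functions that take the value \<open>\<zero>\<^bsub>R\<^esub>\<close> outside \<open>carrier G\<close>.
  Hence the coefficient of \<open>x\<close> in a product, the sum of all \<open>f y \<otimes> g z\<close> with \<open>y \<otimes> z = x\<close>, only
  has to range over the supports, which makes it a finite sum.
\<close>

definition group_ring_carrier ::
    "('a, 'm) ring_scheme \<Rightarrow> ('g, 'n) monoid_scheme \<Rightarrow> ('g \<Rightarrow> 'a) set" where
  "group_ring_carrier R G =
     {f. range f \<subseteq> carrier R \<and> {x. f x \<noteq> \<zero>\<^bsub>R\<^esub>} \<subseteq> carrier G \<and> finite {x. f x \<noteq> \<zero>\<^bsub>R\<^esub>}}"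

definition group_ring ::
    "('a, 'm) ring_scheme \<Rightarrow> ('g, 'n) monoid_scheme \<Rightarrow> ('g \<Rightarrow> 'a) ring" where
  "group_ring R G =
     \<lparr> carrier = group_ring_carrier R G,
       monoid.mult = (\<lambda>f g x. finsum R (\<lambda>(y, z). f y \<otimes>\<^bsub>R\<^esub> g z)
                         {(y, z). f y \<noteq> \<zero>\<^bsub>R\<^esub> \<and> g z \<noteq> \<zero>\<^bsub>R\<^esub> \<and> y \<otimes>\<^bsub>G\<^esub> z = x}),
       monoid.one = (\<lambda>x. if x = \<one>\<^bsub>G\<^esub> then \<one>\<^bsub>R\<^esub> else \<zero>\<^bsub>R\<^esub>),
       ring.zero = (\<lambda>x. \<zero>\<^bsub>R\<^esub>),
       ring.add = (\<lambda>f g x. f x \<oplus>\<^bsub>R\<^esub> g x) \<rparr>"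

definition nilpotents :: "('a, 'm) ring_scheme \<Rightarrow> 'a set" where
  "nilpotents R = {a \<in> carrier R. \<exists>n::nat. a [^]\<^bsub>R\<^esub> n = \<zero>\<^bsub>R\<^esub>}"

definition idempotents :: "('a, 'm) ring_scheme \<Rightarrow> 'a set" where
  "idempotents R = {e \<in> carrier R. e \<otimes>\<^bsub>R\<^esub> e = e}"

definition uniquely_nil_clean :: "('a, 'm) ring_scheme \<Rightarrow> 'a \<Rightarrow> bool" where
  "uniquely_nil_clean R a \<longleftrightarrow> (\<exists>!e. e \<in> idempotents R \<and> a \<ominus>\<^bsub>R\<^esub> e \<in> nilpotents R)"

definition GUNC :: "('a, 'm) ring_scheme \<Rightarrow> bool" where
  "GUNC R \<longleftrightarrow> (\<forall>a \<in> carrier R - Units R. uniquely_nil_clean R a)"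

text \<open>\<open>group.ord\<close> is \<open>0\<close> on elements of infinite order, so these are excluded for \<open>p > 0\<close>.\<close>

definition p_group :: "nat \<Rightarrow> ('g, 'n) monoid_scheme \<Rightarrow> bool" where
  "p_group p G \<longleftrightarrow> group G \<and> (\<forall>x \<in> carrier G. \<exists>n. group.ord G x = p ^ n)"

definition locally_finite_group :: "('g, 'n) monoid_scheme \<Rightarrow> bool" where
  "locally_finite_group G \<longleftrightarrow>
     group G \<and> (\<forall>S \<subseteq> carrier G. finite S \<longrightarrow> finite (generate G S))"

end

theory Submission
  imports Defs
begin

text \<open>
  The crux is that the kernel of the augmentation \<open>RG \<rightarrow> R\<close> is nil when \<open>p\<close> is nilpotent in \<open>R\<close>.
  The support of a kernel element generates a finite \<open>p\<close>-group \<open>H\<close>; let \<open>A\<close> be the set of elements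
  killed by all long enough products of factors \<open>h - 1\<close>, and \<open>M\<close> the additive group spanned by \<open>H\<close>,
  which is a finite \<open>p\<close>-group. If \<open>M\<close> were not contained in \<open>A\<close>, then counting fixed points of \<open>H\<close> on the
  cosets of \<open>M \<inter> A\<close> in \<open>M\<close> would give \<open>x \<in> M - A\<close> with \<open>(h - 1) x \<in> A\<close> for all \<open>h\<close>, which is absurd.
  Hence \<open>1 \<in> A\<close>, and a power of the kernel element vanishes.

  Since \<open>e + x\<close> is idempotent and \<open>x\<close> square-zero for \<open>x = e r (1 - e)\<close>, idempotents of a GUNC ring are
  central, so idempotents of \<open>RG\<close> that agree with a scalar idempotent modulo the nil kernel are equal
  to it; this lifts GUNC from \<open>R\<close> to \<open>RG\<close>. Conversely \<open>R\<close> is a retract of \<open>RG\<close>. For \<open>g \<noteq> 1\<close> of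
  order \<open>q\<close>, the idempotent attached to the non-unit \<open>1 - g\<close> is central of augmentation \<open>0\<close>, which
  forces it to be \<open>0\<close>, so \<open>1 - g\<close> is nilpotent. Then so is \<open>y = q - (1 + g + \<dots> + g\<^sup>q\<^sup>-\<^sup>1)\<close>, a multiple
  of \<open>1 - g\<close>; as \<open>y\<^sup>2 = q y\<close>, comparing coefficients at \<open>g\<close> shows that \<open>q\<close> is nilpotent in \<open>R\<close>.
\<close>

section \<open>Finite p-groups\<close>

text \<open>By Cauchy's theorem, a prime \<open>q\<close> other than \<open>p\<close> dividing the
  order would give a subgroup of order \<open>q\<close>. A nontrivial element of it would have order
  dividing both \<open>q\<close> and a power of \<open>p\<close>, hence order 1.\<close>

lemma (in group) order_eq_prime_power:
  assumes fin: "finite (carrier G)" and p: "Factorial_Ring.prime p"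
    and tor: "\<And>x. x \<in> carrier G \<Longrightarrow> \<exists>n. x [^] (p ^ n :: nat) = \<one>"
  shows "\<exists>n. order G = p ^ n"
proof -
  have pos: "order G \<noteq> 0"
    using fin order_gt_0_iff_finite by auto
  have only_p: "q = p" if q: "Factorial_Ring.prime q" "q dvd order G" for q
  proof (rule ccontr)
    assume "q \<noteq> p"
    \<comment> \<open>The exponent 1 turns Sylow's theorem into Cauchy's theorem.\<close>
    obtain m where "order G = q ^ 1 * m"
      using q(2) by auto
    then obtain H where H: "subgroup H G" "card H = q"
      using sylow_thm[OF q(1) is_group _ fin] by fastforce
    interpret H: group "G\<lparr>carrier := H\<rparr>"
      using H(1) subgroup.subgroup_is_group is_group by blast
    have "card H \<ge> 2"
      using H(2) q(1) prime_ge_2_nat by auto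
    then have "\<not> H \<subseteq> {\<one>}"
      using card_mono[of "{\<one>}" H] by force
    then obtain x where x: "x \<in> H" "x \<noteq> \<one>"
      by blast
    then have xG: "x \<in> carrier G"
      using H(1) subgroup.subset by blast
    have "x [^] q = \<one>"
      using H.pow_order_eq_1[of x] x H(2) by (simp add: order_def nat_pow_consistent[symmetric])
    moreover obtain n where "x [^] (p ^ n) = \<one>"
      using tor xG by blast
    moreover have "coprime q (p ^ n)"
      using primes_coprime[OF q(1) p \<open>q \<noteq> p\<close>] by simp
    ultimately have "ord x = 1"
      using pow_eq_id[OF xG] by (metis coprime_common_divisor_nat)
    then show False
      using ord_eq_1[OF xG] x(2) by simp
  qed
  obtain m where m: "order G = p ^ multiplicity p (order G) * m" "\<not> p dvd m"
    using multiplicity_decompose'[OF pos] p not_prime_unit by blast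
  have "m = 1"
  proof (rule ccontr)
    assume "m \<noteq> 1"
    then obtain q where "Factorial_Ring.prime q" "q dvd m"
      using prime_factor_nat by blast
    then show False
      using only_p[of q] m by (metis dvd_mult)
  qed
  then show ?thesis
    using m(1) by auto
qed

text \<open>Orbit sizes divide \<open>p ^ n\<close>, so an orbit with more than one element has size
  divisible by \<open>p\<close>. If \<open>x0\<close> were the only fixed point,
  \<open>card Y\<close> would be 1 modulo \<open>p\<close>.\<close>

lemma (in group) exists_other_fixed_point:
  fixes act :: "'a \<Rightarrow> 'x \<Rightarrow> 'x"
  assumes p: "Factorial_Ring.prime p" and ord: "order G = p ^ n"
    and Y: "finite Y" "p dvd card Y"
    and closed: "\<And>g x. g \<in> carrier G \<Longrightarrow> x \<in> Y \<Longrightarrow> act g x \<in> Y"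
    and act_one: "\<And>x. x \<in> Y \<Longrightarrow> act \<one> x = x"
    and act_mult: "\<And>g h x. g \<in> carrier G \<Longrightarrow> h \<in> carrier G \<Longrightarrow> x \<in> Y \<Longrightarrow>
      act (g \<otimes> h) x = act g (act h x)"
    and x0: "x0 \<in> Y" "\<And>g. g \<in> carrier G \<Longrightarrow> act g x0 = x0"
  shows "\<exists>x\<in>Y. x \<noteq> x0 \<and> (\<forall>g\<in>carrier G. act g x = x)"
proof (rule ccontr)
  assume none: "\<not> ?thesis"
  \<comment> \<open>Members of \<open>BijGroup Y\<close> are extensional on \<open>Y\<close>, so the
    plain function \<open>act g\<close> has to be restricted before the orbit theorems
    apply.\<close>
  define \<phi> where "\<phi> = (\<lambda>g. restrict (act g) Y)"
  have bij: "bij_betw (act g) Y Y" if "g \<in> carrier G" for g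
    by (rule bij_betwI[where g = "act (inv g)"])
      (use that closed act_mult[symmetric] act_one in \<open>auto simp: Pi_def\<close>)
  have phi_Bij: "\<phi> g \<in> Bij Y" if "g \<in> carrier G" for g
    using bij[OF that] unfolding Bij_def \<phi>_def by (auto simp: bij_betw_restrict_eq)
  have "group_hom G (BijGroup Y) \<phi>"
  proof (intro group_hom.intro group_hom_axioms.intro is_group group_BijGroup homI)
    show "\<phi> g \<in> carrier (BijGroup Y)" if "g \<in> carrier G" for g
      using phi_Bij[OF that] by (simp add: BijGroup_def)
    show "\<phi> (g \<otimes> h) = \<phi> g \<otimes>\<^bsub>BijGroup Y\<^esub> \<phi> h" if "g \<in> carrier G" "h \<in> carrier G" for g h
      using that phi_Bij closed act_mult
      by (auto simp: BijGroup_def compose_def \<phi>_def restrict_def fun_eq_iff)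
  qed
  then interpret A: group_action G Y \<phi>
    by (rule group_action.intro)
  define \<O> where "\<O> = orbits G Y \<phi>"
  have orbX: "orb \<subseteq> Y" "finite orb" if "orb \<in> \<O>" for orb
  proof -
    show "orb \<subseteq> Y"
      using that A.orbits_coverture unfolding \<O>_def by (metis Union_upper)
    then show "finite orb"
      using Y(1) finite_subset by blast
  qed
  have orb_x0: "orbit G \<phi> x0 = {x0}"
    using x0 unfolding orbit_def \<phi>_def by (auto intro!: exI[of _ "\<one>"])
  have in_O: "{x0} \<in> \<O>"
    using x0(1) orb_x0 unfolding \<O>_def orbits_def by blast
  have dvd: "p dvd card orb" if orb: "orb \<in> \<O>" "orb \<noteq> {x0}" for orb
  proof -
    obtain x where x: "x \<in> Y" "orb = orbit G \<phi> x"
      using orb unfolding \<O>_def orbits_def by blast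
    have "x \<noteq> x0"
      using orb x orb_x0 by auto
    then obtain g where g: "g \<in> carrier G" "act g x \<noteq> x"
      using none x by blast
    have "x \<in> orb" "act g x \<in> orb"
      using x A.orbit_refl g unfolding orbit_def \<phi>_def by auto
    then have ne1: "card orb \<noteq> 1"
      using g(2) by (auto simp: card_1_singleton_iff)
    have "card orb dvd p ^ n"
      unfolding x(2) ord[symmetric] A.orbit_stabilizer_theorem[OF x(1), symmetric] by simp
    then obtain i where "card orb = p ^ i"
      using divides_primepow_nat[OF p] by blast
    then show ?thesis
      using ne1 by (cases i) auto
  qed
  have "card Y = (\<Sum>orb\<in>\<O>. card orb)"
    using A.disjoint_sum[OF Y(1), of "\<lambda>_. 1::nat"] unfolding \<O>_def by simp
  also have "\<dots> = 1 + (\<Sum>orb\<in>\<O> - {{x0}}. card orb)"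
  proof -
    have "finite \<O>"
      using Y(1) unfolding \<O>_def orbits_def by auto
    then show ?thesis
      using sum.remove[OF _ in_O, of card] by simp
  qed
  finally have "p dvd 1 + (\<Sum>orb\<in>\<O> - {{x0}}. card orb)"
    using Y(2) by simp
  moreover have "p dvd (\<Sum>orb\<in>\<O> - {{x0}}. card orb)"
    using dvd by (intro dvd_sum) auto
  ultimately have "p dvd 1"
    using dvd_add_left_iff by blast
  then show False
    using p not_prime_unit by blast
qed

text \<open>In a commutative group the product of the finite subgroup generated by \<open>F\<close>
  and the finite cyclic subgroup generated by \<open>x\<close> is again a finite subgroup, and it
  contains all generators. The condition \<open>ord x \<noteq> 0\<close> says that \<open>x\<close>
  has finite order.\<close>

lemma (in comm_group) finite_generate_torsion:
  assumes "finite S" "S \<subseteq> carrier G" "\<And>x. x \<in> S \<Longrightarrow> ord x \<noteq> 0"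
  shows "finite (generate G S)"
  using assms
proof (induction S)
  case empty
  then show ?case by (simp add: generate_empty)
next
  case (insert x F)
  have x: "x \<in> carrier G" and F: "F \<subseteq> carrier G"
    using insert.prems by auto
  have "finite (generate G {x})"
    using generate_pow_card[OF x] insert.prems(2)[of x] card.infinite by force
  moreover have "finite (generate G F)"
    using insert by auto
  ultimately have fin: "finite (generate G F <#> generate G {x})"
    unfolding set_mult_def by auto
  have sub: "subgroup (generate G F <#> generate G {x}) G"
    by (intro mult_subgroups generate_is_subgroup) (use x F in auto)
  have "generate G F <#> generate G {x} \<supseteq> insert x F"
  proof
    fix y assume y: "y \<in> insert x F"
    show "y \<in> generate G F <#> generate G {x}"
    proof (cases "y = x")
      case True
      then show ?thesis
        unfolding set_mult_def using generate.one[of G F] generate.incl[of x "{x}" G] x by force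
    next
      case False
      then show ?thesis
        unfolding set_mult_def using y generate.one[of G "{x}"] generate.incl[of y F G] F by force
    qed
  qed
  then show ?case
    using generate_subgroup_incl[OF _ sub] fin finite_subset by blast
qed

section \<open>Nilpotents and idempotents\<close>

lemma nilpotentsI: "a \<in> carrier R \<Longrightarrow> a [^]\<^bsub>R\<^esub> (n::nat) = \<zero>\<^bsub>R\<^esub> \<Longrightarrow> a \<in> nilpotents R"
  unfolding nilpotents_def by blast

lemma nilpotentsE:
  assumes "a \<in> nilpotents R"
  obtains n :: nat where "a \<in> carrier R" "a [^]\<^bsub>R\<^esub> n = \<zero>\<^bsub>R\<^esub>"
  using assms unfolding nilpotents_def by blast

lemma idempotentsD:
  assumes "e \<in> idempotents R"
  shows "e \<in> carrier R" "e \<otimes>\<^bsub>R\<^esub> e = e"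
  using assms unfolding idempotents_def by blast+

context ring
begin

lemma nilpotents_closed: "a \<in> nilpotents R \<Longrightarrow> a \<in> carrier R"
  unfolding nilpotents_def by blast

lemma nilpotents_mult_commute:
  assumes a: "a \<in> nilpotents R" and b: "b \<in> carrier R" "a \<otimes> b = b \<otimes> a"
  shows "a \<otimes> b \<in> nilpotents R"
proof -
  obtain n :: nat where n: "a \<in> carrier R" "a [^] n = \<zero>"
    using a by (rule nilpotentsE)
  have "(a \<otimes> b) [^] n = \<zero>"
    using pow_mult_distrib[OF b(2) n(1) b(1), of n] n b(1) by simp
  then show ?thesis
    using n(1) b(1) by (blast intro: nilpotentsI)
qed

lemma nilpotents_uminus:
  assumes "a \<in> nilpotents R"
  shows "\<ominus> a \<in> nilpotents R"
proof -
  have a: "a \<in> carrier R"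
    using assms nilpotents_closed by blast
  have "a \<otimes> (\<ominus> \<one>) \<in> nilpotents R"
    by (rule nilpotents_mult_commute[OF assms]) (use a in \<open>simp_all add: r_minus l_minus\<close>)
  then show ?thesis
    using a by (simp add: r_minus)
qed

lemma nilpotents_of_pow:
  assumes "a \<in> carrier R" "a [^] (n::nat) \<in> nilpotents R"
  shows "a \<in> nilpotents R"
  using assms unfolding nilpotents_def by (auto simp: nat_pow_pow)

lemma idempotent_nilpotent_eq_zero:
  assumes "e \<in> idempotents R" "e \<in> nilpotents R"
  shows "e = \<zero>"
proof -
  obtain n :: nat where n: "e [^] n = \<zero>"
    using assms(2) by (rule nilpotentsE)
  have e: "e \<in> carrier R" "e \<otimes> e = e"
    using idempotentsD[OF assms(1)] by auto
  have "e [^] (Suc k) = e" for k :: nat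
    by (induction k) (use e in auto)
  then show ?thesis
    using n e(1) nat_pow_Suc[of e n] by (metis l_null)
qed

section \<open>Geometric sums and multiples of \<open>1 - g\<close>\<close>

lemma geometric_sum:
  assumes g: "g \<in> carrier R"
  shows "(\<one> \<ominus> g) \<otimes> (\<Oplus>j\<in>{..<i::nat}. g [^] j) = \<one> \<ominus> g [^] i"
    and "(\<Oplus>j\<in>{..<i}. g [^] j) \<otimes> (\<one> \<ominus> g) = \<one> \<ominus> g [^] i"
proof -
  have tele: "(\<one> \<ominus> x) \<oplus> (x \<ominus> y) = \<one> \<ominus> y" if "x \<in> carrier R" "y \<in> carrier R" for x y
    using that by (simp add: minus_eq a_assoc r_neg1 r_neg2)
  have fin: "(\<Oplus>j\<in>{..<Suc i}. g [^] j) = (\<Oplus>j\<in>{..<i}. g [^] j) \<oplus> g [^] i" for i :: nat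
    unfolding lessThan_Suc using g by (simp add: Pi_def a_comm)
  have cl: "(\<Oplus>j\<in>{..<i}. g [^] j) \<in> carrier R" for i :: nat
    using g by (simp add: Pi_def)
  have comm: "g \<otimes> g [^] i = g [^] i \<otimes> g" for i :: nat
    using g by (metis nat_pow_Suc nat_pow_Suc2)
  show "(\<one> \<ominus> g) \<otimes> (\<Oplus>j\<in>{..<i}. g [^] j) = \<one> \<ominus> g [^] i"
  proof (induction i)
    case 0
    show ?case using g by (simp add: minus_eq r_neg)
  next
    case (Suc i)
    have "(\<one> \<ominus> g) \<otimes> g [^] i = g [^] i \<ominus> g [^] Suc i"
      using g comm by (simp add: minus_eq l_distr l_minus)
    then show ?case
      unfolding fin using g cl Suc tele by (simp add: r_distr del: nat_pow_Suc)
  qed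
  show "(\<Oplus>j\<in>{..<i}. g [^] j) \<otimes> (\<one> \<ominus> g) = \<one> \<ominus> g [^] i"
  proof (induction i)
    case 0
    show ?case using g by (simp add: minus_eq r_neg)
  next
    case (Suc i)
    have "g [^] i \<otimes> (\<one> \<ominus> g) = g [^] i \<ominus> g [^] Suc i"
      using g by (simp add: minus_eq r_distr r_minus)
    then show ?case
      unfolding fin using g cl Suc tele by (simp add: l_distr del: nat_pow_Suc)
  qed
qed

text \<open>The geometric series of \<open>a\<close> terminates and is a two-sided inverse.\<close>

lemma one_minus_nilpotent_Units:
  assumes "a \<in> nilpotents R"
  shows "\<one> \<ominus> a \<in> Units R"
proof -
  obtain n :: nat where n: "a \<in> carrier R" "a [^] n = \<zero>"
    using assms by (rule nilpotentsE)
  let ?s = "\<Oplus>j\<in>{..<n}. a [^] j"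
  have "?s \<in> carrier R" "(\<one> \<ominus> a) \<otimes> ?s = \<one>" "?s \<otimes> (\<one> \<ominus> a) = \<one>"
    using geometric_sum[OF n(1), of n] n by (simp_all add: Pi_def minus_eq)
  then show ?thesis
    unfolding Units_def using n(1) by (auto simp: minus_eq)
qed

text \<open>The cofactor \<open>s\<close> is the geometric sum. That it commutes with
  \<open>g\<close> is recorded because a multiple of a nilpotent element is known to be nilpotent
  only when the factors commute.\<close>

lemma one_minus_pow_multiple:
  assumes g: "g \<in> carrier R"
  shows "\<exists>s\<in>carrier R. s \<otimes> g = g \<otimes> s \<and> \<one> \<ominus> g [^] (i::nat) = s \<otimes> (\<one> \<ominus> g)"
proof (intro bexI conjI)
  show "(\<Oplus>j\<in>{..<i}. g [^] j) \<in> carrier R"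
    using g by (simp add: Pi_def)
  show "\<one> \<ominus> g [^] i = (\<Oplus>j\<in>{..<i}. g [^] j) \<otimes> (\<one> \<ominus> g)"
    using geometric_sum[OF g] by simp
  have comm: "g [^] i \<otimes> g = g \<otimes> g [^] i" for i :: nat
    using g by (metis nat_pow_Suc nat_pow_Suc2)
  show "(\<Oplus>j\<in>{..<i}. g [^] j) \<otimes> g = g \<otimes> (\<Oplus>j\<in>{..<i}. g [^] j)"
    using g comm by (simp add: finsum_ldistr finsum_rdistr Pi_def)
qed

text \<open>The left side is the sum of \<open>1 - g^j\<close> over \<open>j < i\<close>, and each
  summand is a multiple of \<open>1 - g\<close>. Thus it is nilpotent as soon as
  \<open>1 - g\<close> is.\<close>

lemma multiple_minus_geometric_sum:
  assumes g: "g \<in> carrier R"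
  shows "\<exists>s\<in>carrier R. s \<otimes> g = g \<otimes> s \<and> add_pow R (i::nat) \<one> \<ominus> (\<Oplus>j\<in>{..<i}. g [^] j) = s \<otimes> (\<one> \<ominus> g)"
proof (induction i)
  case 0
  then show ?case using g by (intro bexI[of _ "\<zero>"]) (simp_all add: minus_eq r_neg)
next
  case (Suc i)
  then obtain s where s: "s \<in> carrier R" "s \<otimes> g = g \<otimes> s"
    "add_pow R i \<one> \<ominus> (\<Oplus>j\<in>{..<i}. g [^] j) = s \<otimes> (\<one> \<ominus> g)" by blast
  obtain t where t: "t \<in> carrier R" "t \<otimes> g = g \<otimes> t" "\<one> \<ominus> g [^] i = t \<otimes> (\<one> \<ominus> g)"
    using one_minus_pow_multiple[OF g] by blast
  have cl: "(\<Oplus>j\<in>{..<i}. g [^] j) \<in> carrier R"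
    using g by (simp add: Pi_def)
  have "add_pow R (Suc i) \<one> \<ominus> (\<Oplus>j\<in>{..<Suc i}. g [^] j)
      = (add_pow R i \<one> \<ominus> (\<Oplus>j\<in>{..<i}. g [^] j)) \<oplus> (\<one> \<ominus> g [^] i)"
    unfolding lessThan_Suc using g cl by (simp add: Pi_def minus_eq minus_add a_ac)
  also have "\<dots> = (s \<oplus> t) \<otimes> (\<one> \<ominus> g)"
    using s t g by (simp add: l_distr)
  finally show ?case
    using s t g by (intro bexI[of _ "s \<oplus> t"]) (simp_all add: l_distr r_distr)
qed

text \<open>The elements \<open>f (1 - e)\<close> and \<open>e (1 - f)\<close> are idempotent
  because \<open>e\<close> and \<open>f\<close> commute. Up to sign they are the products of
  \<open>f - e\<close> with \<open>1 - e\<close> and \<open>1 - f\<close>, hence nilpotent. So both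
  vanish, which gives \<open>f = f e = e f = e\<close>.\<close>

lemma central_idempotent_unique:
  assumes e: "e \<in> idempotents R" and f: "f \<in> idempotents R"
    and central: "e \<otimes> f = f \<otimes> e" and nil: "f \<ominus> e \<in> nilpotents R"
  shows "f = e"
proof -
  have c: "e \<in> carrier R" "f \<in> carrier R" "e \<otimes> e = e" "f \<otimes> f = f"
    using idempotentsD[OF e] idempotentsD[OF f] by auto
  have c2: "f \<otimes> (f \<otimes> x) = f \<otimes> x" "e \<otimes> (e \<otimes> x) = e \<otimes> x" "f \<otimes> (e \<otimes> x) = e \<otimes> (f \<otimes> x)"
    if "x \<in> carrier R" for x
    using that c central by (metis m_assoc)+
  have u: "f \<otimes> (\<one> \<ominus> e) \<in> idempotents R" "e \<otimes> (\<one> \<ominus> f) \<in> idempotents R"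
    unfolding idempotents_def using c c2 central[symmetric]
    by (simp_all add: minus_eq l_distr r_distr m_assoc l_minus r_minus r_neg)
  have orth: "e \<otimes> (\<one> \<oplus> \<ominus> e) = \<zero>" "f \<otimes> (\<one> \<oplus> \<ominus> f) = \<zero>"
    using c by (simp_all add: r_distr r_minus r_neg)
  have "(f \<ominus> e) \<otimes> (\<one> \<ominus> e) = f \<otimes> (\<one> \<ominus> e)" "(f \<ominus> e) \<otimes> (\<one> \<ominus> f) = \<ominus> (e \<otimes> (\<one> \<ominus> f))"
    using c orth by (simp_all add: minus_eq l_distr l_minus)
  moreover have "(f \<ominus> e) \<otimes> (\<one> \<ominus> e) = (\<one> \<ominus> e) \<otimes> (f \<ominus> e)"
    "(f \<ominus> e) \<otimes> (\<one> \<ominus> f) = (\<one> \<ominus> f) \<otimes> (f \<ominus> e)"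
    using c central by (simp_all add: minus_eq l_distr r_distr m_assoc l_minus r_minus a_ac minus_add)
  ultimately have "f \<otimes> (\<one> \<ominus> e) \<in> nilpotents R" "\<ominus> (e \<otimes> (\<one> \<ominus> f)) \<in> nilpotents R"
    using nilpotents_mult_commute[OF nil] c by (metis minus_closed one_closed)+
  then have "f \<otimes> (\<one> \<ominus> e) \<in> nilpotents R" "e \<otimes> (\<one> \<ominus> f) \<in> nilpotents R"
    using nilpotents_uminus c by fastforce+
  then have "f \<otimes> (\<one> \<ominus> e) = \<zero>" "e \<otimes> (\<one> \<ominus> f) = \<zero>"
    using u idempotent_nilpotent_eq_zero by blast+
  then have "f = f \<otimes> e" "e = e \<otimes> f"
    using c by (simp_all add: minus_eq r_distr r_minus r_right_minus_eq[unfolded minus_eq])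
  then show ?thesis
    using central by simp
qed

text \<open>The conditions on \<open>x\<close> make \<open>e + x\<close> idempotent. Both
  \<open>e - e\<close> and \<open>e - (e + x)\<close> are nilpotent, so uniqueness for the non-unit
  \<open>e\<close> forces \<open>e + x = e\<close>.\<close>

lemma idempotent_add_orthogonal_eq:
  assumes G: "GUNC R" and e: "e \<in> idempotents R" "e \<notin> Units R"
    and x: "x \<in> carrier R" "x \<otimes> x = \<zero>" "e \<otimes> x \<oplus> x \<otimes> e = x"
  shows "x = \<zero>"
proof -
  have c: "e \<in> carrier R" "e \<otimes> e = e"
    using idempotentsD[of e R] e by auto
  have "(e \<oplus> x) \<otimes> (e \<oplus> x) = e \<oplus> (e \<otimes> x \<oplus> x \<otimes> e)"
    using c x(1,2) by (simp add: l_distr r_distr a_ac)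
  then have f: "e \<oplus> x \<in> idempotents R"
    unfolding idempotents_def using c x by simp
  have "e \<ominus> (e \<oplus> x) = \<ominus> x"
    using c x(1) by (simp add: minus_eq minus_add r_neg1 r_neg2)
  moreover have "x \<in> nilpotents R"
    using x(1,2) by (intro nilpotentsI[of _ _ 2]) (simp_all add: numeral_2_eq_2)
  ultimately have "e \<ominus> (e \<oplus> x) \<in> nilpotents R"
    using nilpotents_uminus by simp
  moreover have "e \<ominus> e \<in> nilpotents R"
    using c by (intro nilpotentsI[of _ _ 1]) (simp_all add: minus_eq r_neg)
  moreover have "uniquely_nil_clean R e"
    using G c e(2) unfolding GUNC_def by blast
  ultimately have "e \<oplus> x = e"
    using e(1) f unfolding uniquely_nil_clean_def by blast
  then show ?thesis
    using c x(1) by (metis r_zero add.l_cancel zero_closed)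
qed

text \<open>An invertible idempotent is 1. Otherwise the preceding lemma kills both off-diagonal
  Peirce components \<open>e r (1 - e)\<close> and \<open>(1 - e) r e\<close>, so
  \<open>e r = e r e = r e\<close>.\<close>

lemma GUNC_idempotent_central:
  assumes G: "GUNC R" and e: "e \<in> idempotents R" and r: "r \<in> carrier R"
  shows "e \<otimes> r = r \<otimes> e"
proof (cases "e \<in> Units R")
  case True
  have "e \<otimes> e = e \<otimes> \<one>"
    using idempotentsD[OF e] by simp
  then have "e = \<one>"
    using True Units_l_cancel[of e e \<one>] by auto
  then show ?thesis using r by simp
next
  case False
  have c: "e \<in> carrier R" "e \<otimes> e = e"
    using idempotentsD[of e R] e by auto
  have c2: "e \<otimes> (e \<otimes> x) = e \<otimes> x" if "x \<in> carrier R" for x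
    using that c by (metis m_assoc)
  have "e \<otimes> r \<otimes> (\<one> \<ominus> e) = \<zero>"
    by (rule idempotent_add_orthogonal_eq[OF G e False])
      (use c c2 r in \<open>simp_all add: minus_eq l_distr r_distr m_assoc l_minus r_minus r_neg a_ac\<close>)
  moreover have "(\<one> \<ominus> e) \<otimes> r \<otimes> e = \<zero>"
    by (rule idempotent_add_orthogonal_eq[OF G e False])
      (use c c2 r in \<open>simp_all add: minus_eq l_distr r_distr m_assoc l_minus r_minus r_neg a_ac\<close>)
  ultimately have "e \<otimes> r = e \<otimes> r \<otimes> e" "r \<otimes> e = e \<otimes> r \<otimes> e"
    using c r by (simp_all add: minus_eq l_distr r_distr m_assoc l_minus r_minus
        r_right_minus_eq[unfolded minus_eq])
  then show ?thesis by simp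
qed

section \<open>Integer multiples of the identity\<close>

lemma natmult_one_mult: "x \<in> carrier R \<Longrightarrow> add_pow R (n::nat) x = (add_pow R n \<one>) \<otimes> x"
  by (simp add: add_pow_ldistr)

text \<open>Translates nilpotency of \<open>p\<close> times \<open>\<one>\<close> into the vanishing
  of some \<open>p ^ k\<close> times \<open>\<one>\<close>, so that \<open>p ^ k\<close> annihilates
  the whole additive group.\<close>

lemma natmult_one_pow: "(add_pow R (n::nat) \<one>) [^] (k::nat) = add_pow R (n ^ k) \<one>"
proof (induction k)
  case (Suc k)
  have "(add_pow R n \<one>) [^] Suc k = add_pow R (n ^ k) (add_pow R n \<one>)"
    using Suc by (simp add: add_pow_ldistr)
  then show ?case
    by (simp add: add.nat_pow_pow mult.commute)
qed simp

end

section \<open>Finite p-groups of units\<close>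

text \<open>Stage \<open>j\<close> consists of the elements killed by left multiplication with every
  product of \<open>j\<close> factors \<open>u - 1\<close>. When \<open>U\<close> is a group of
  units this is the annihilator of the \<open>j\<close>-th power of its augmentation ideal, so the
  stages form an ascending Loewy series of fixed points. Stage 0 belongs to the empty
  product.\<close>

primrec augmentation_annihilator :: "('a, 'm) ring_scheme \<Rightarrow> 'a set \<Rightarrow> nat \<Rightarrow> 'a set" where
  "augmentation_annihilator R U 0 = {\<zero>\<^bsub>R\<^esub>}"
| "augmentation_annihilator R U (Suc j) =
     {x \<in> carrier R. \<forall>u\<in>U. (u \<ominus>\<^bsub>R\<^esub> \<one>\<^bsub>R\<^esub>) \<otimes>\<^bsub>R\<^esub> x \<in> augmentation_annihilator R U j}"

context ring
begin

context
  fixes U :: "'a set"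
  assumes U: "U \<subseteq> carrier R"
begin

lemma augmentation_annihilator_closed: "x \<in> augmentation_annihilator R U j \<Longrightarrow> x \<in> carrier R"
  by (cases j) auto

lemma augmentation_annihilator_zero: "\<zero> \<in> augmentation_annihilator R U j"
  using U by (induction j) (auto simp: subset_iff minus_eq)

lemma augmentation_annihilator_add:
  "x \<in> augmentation_annihilator R U j \<Longrightarrow> y \<in> augmentation_annihilator R U j \<Longrightarrow> x \<oplus> y \<in> augmentation_annihilator R U j"
  using U by (induction j arbitrary: x y) (auto simp: subset_iff r_distr)

text \<open>An element commuting with \<open>U\<close> can be moved past all factors
  \<open>u - 1\<close>. This serves for the sign \<open>-1\<close> and later for the coefficients of
  a group ring element.\<close>

lemma augmentation_annihilator_mult:
  assumes "c \<in> carrier R" "\<And>u. u \<in> U \<Longrightarrow> u \<otimes> c = c \<otimes> u"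
  shows "x \<in> augmentation_annihilator R U j \<Longrightarrow> c \<otimes> x \<in> augmentation_annihilator R U j"
proof (induction j arbitrary: x)
  case (Suc j)
  have "(u \<ominus> \<one>) \<otimes> (c \<otimes> x) = c \<otimes> ((u \<ominus> \<one>) \<otimes> x)" if u: "u \<in> U" for u
  proof -
    have "(u \<ominus> \<one>) \<otimes> c = c \<otimes> (u \<ominus> \<one>)"
      using assms u U by (auto simp: minus_eq l_distr r_distr l_minus r_minus)
    then show ?thesis
      using assms(1) u U Suc.prems by (simp add: m_assoc[symmetric] subset_iff)
  qed
  then show ?case
    using Suc assms(1) by auto
qed (use assms in simp)

lemma augmentation_annihilator_uminus: "x \<in> augmentation_annihilator R U j \<Longrightarrow> \<ominus> x \<in> augmentation_annihilator R U j"
  using augmentation_annihilator_mult[of "\<ominus> \<one>" x j] augmentation_annihilator_closed[of x j] U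
  by (simp add: l_minus r_minus subset_iff)

lemma augmentation_annihilator_mono:
  assumes "i \<le> j" shows "augmentation_annihilator R U i \<subseteq> augmentation_annihilator R U j"
proof -
  have "augmentation_annihilator R U j \<subseteq> augmentation_annihilator R U (Suc j)" for j
  proof (induction j)
    case 0
    show ?case using U by (auto simp: minus_eq)
  qed (use U in auto)
  then show ?thesis
    using assms by (rule lift_Suc_mono_le)
qed

text \<open>Write \<open>u x = (u - 1) x + x\<close>; the first summand lies one stage
  lower.\<close>

lemma augmentation_annihilator_act:
  assumes u: "u \<in> U" and x: "x \<in> augmentation_annihilator R U j"
  shows "u \<otimes> x \<in> augmentation_annihilator R U j"
proof (cases j)
  case 0
  then show ?thesis using x u U by auto
next
  case (Suc i)
  have c: "u \<in> carrier R" "x \<in> carrier R"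
    using u U x augmentation_annihilator_closed by blast+
  have "(u \<ominus> \<one>) \<otimes> x \<in> augmentation_annihilator R U j"
    using x u augmentation_annihilator_mono[of i j] unfolding Suc by auto
  then have "(u \<ominus> \<one>) \<otimes> x \<oplus> x \<in> augmentation_annihilator R U j"
    using x augmentation_annihilator_add by blast
  moreover have "(u \<ominus> \<one>) \<otimes> x \<oplus> x = u \<otimes> x"
    using c by (simp add: minus_eq l_distr l_minus a_assoc l_neg)
  ultimately show ?thesis by simp
qed

end

text \<open>A fixed point of a \<open>p\<close>-group acting on the cosets of the annihilated part
  shows that this part is everything. The group enters only through a multiplicative map
  \<open>\<delta>\<close>, so that the lemma can be applied inside a group ring to the map sending
  group elements to their basis vectors.\<close>

lemma one_in_augmentation_annihilator:
  fixes H :: "('h, 'n) monoid_scheme" and \<delta> :: "'h \<Rightarrow> 'a"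
  assumes H: "group H" and p: "Factorial_Ring.prime p" and ord: "order H = p ^ n"
    and pk: "add_pow R (p ^ k :: nat) \<one> = \<zero>"
    and \<delta>: "\<And>h. h \<in> carrier H \<Longrightarrow> \<delta> h \<in> carrier R"
      "\<And>g h. g \<in> carrier H \<Longrightarrow> h \<in> carrier H \<Longrightarrow> \<delta> (g \<otimes>\<^bsub>H\<^esub> h) = \<delta> g \<otimes> \<delta> h"
      "\<delta> \<one>\<^bsub>H\<^esub> = \<one>"
  shows "\<exists>j. \<one> \<in> augmentation_annihilator R (\<delta> ` carrier H) j"
proof -
  interpret H: group H by fact
  define U where "U = \<delta> ` carrier H"
  define A where "A = (\<Union>j. augmentation_annihilator R U j)"
  define M where "M = generate (add_monoid R) U"
  let ?M = "add_monoid R\<lparr>carrier := M\<rparr>"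
  define B where "B = M \<inter> A"
  have p_pos: "p > 0"
    using p prime_gt_0_nat by blast
  have finH: "finite (carrier H)"
    using ord p_pos H.order_gt_0_iff_finite by simp
  have U: "U \<subseteq> carrier R" "finite U"
    using \<delta>(1) finH unfolding U_def by auto
  note annihilator = augmentation_annihilator_closed[OF U(1)] augmentation_annihilator_zero[OF U(1)]
    augmentation_annihilator_add[OF U(1)] augmentation_annihilator_uminus[OF U(1)]
    augmentation_annihilator_act[OF U(1)]
  note mono = augmentation_annihilator_mono[OF U(1)]

  \<comment> \<open>Since \<open>p ^ k\<close> kills the additive group, the finitely generated
    additive group \<open>M\<close> is a finite \<open>p\<close>-group.\<close>
  have tor: "add_pow R (p ^ k) x = \<zero>" if "x \<in> carrier R" for x
    using natmult_one_mult[OF that, of "p ^ k"] that pk by simp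
  have subM: "subgroup M (add_monoid R)"
    unfolding M_def using U(1) by (intro add.generate_is_subgroup) simp
  have McR: "M \<subseteq> carrier R"
    using subgroup.subset[OF subM] by simp
  interpret M: group ?M
    using add.subgroup_imp_group[OF subM] .
  have "finite M"
    unfolding M_def
  proof (rule add.finite_generate_torsion[OF U(2)])
    show "U \<subseteq> carrier R" by (rule U(1))
    show "add.ord x \<noteq> 0" if "x \<in> U" for x
    proof
      assume "add.ord x = 0"
      then show False
        using that U(1) tor[of x] add.pow_eq_id[of x "p ^ k"] p_pos by auto
    qed
  qed
  have "\<exists>N. order ?M = p ^ N"
  proof (rule M.order_eq_prime_power[OF _ p])
    show "finite (carrier ?M)" using \<open>finite M\<close> by simp
    show "\<exists>n. x [^]\<^bsub>?M\<^esub> (p ^ n) = \<one>\<^bsub>?M\<^esub>" if "x \<in> carrier ?M" for x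
      using that McR tor[of x] by (intro exI[of _ k]) (auto simp: add_pow_def nat_pow_def)
  qed
  then obtain N where N: "card M = p ^ N"
    by (auto simp: order_def)

  have MM: "\<zero> \<in> M" "\<And>x y. x \<in> M \<Longrightarrow> y \<in> M \<Longrightarrow> x \<oplus> y \<in> M" "\<And>x. x \<in> M \<Longrightarrow> \<ominus> x \<in> M"
    using subgroup.one_closed[OF subM] subgroup.m_closed[OF subM] subgroup.m_inv_closed[OF subM]
    by (auto simp: a_inv_def)
  \<comment> \<open>\<open>U\<close> is closed under multiplication, so left multiplication by
    \<open>U\<close> preserves its additive span.\<close>
  have actM: "u \<otimes> x \<in> M" if u: "u \<in> U" and x: "x \<in> M" for u x
    using x[unfolded M_def]
  proof (induction x rule: generate.induct)
    case one
    then show ?case using u U(1) MM(1) by auto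
  next
    case (incl v)
    obtain g h where gh: "u = \<delta> g" "v = \<delta> h" "g \<in> carrier H" "h \<in> carrier H"
      using u incl unfolding U_def by blast
    then have "u \<otimes> v \<in> U"
      unfolding U_def using \<delta>(2)[symmetric] by simp
    then show ?case unfolding M_def by (rule generate.incl)
  next
    case (inv v)
    obtain g h where gh: "u = \<delta> g" "v = \<delta> h" "g \<in> carrier H" "h \<in> carrier H"
      using u inv unfolding U_def by blast
    then have "u \<otimes> v \<in> U"
      unfolding U_def using \<delta>(2)[symmetric] by simp
    then have "\<ominus> (u \<otimes> v) \<in> M"
      using MM(3) unfolding M_def by (blast intro: generate.incl)
    moreover have "\<ominus> (u \<otimes> v) = u \<otimes> (inv\<^bsub>add_monoid R\<^esub> v)"
      using u inv U(1) by (auto simp: r_minus subset_iff a_inv_def[symmetric])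
    ultimately show ?case by simp
  next
    case (eng x y)
    have "x \<in> carrier R" "y \<in> carrier R"
      using eng.hyps McR unfolding M_def by auto
    then show ?case
      using eng.IH MM(2) u U(1) by (auto simp: r_distr)
  qed

  have AA: "\<zero> \<in> A" "\<And>x. x \<in> A \<Longrightarrow> \<ominus> x \<in> A" "\<And>u x. u \<in> U \<Longrightarrow> x \<in> A \<Longrightarrow> u \<otimes> x \<in> A"
    unfolding A_def by (auto intro: annihilator(2,4,5))
  \<comment> \<open>The stages increase, so both summands can be placed in the later of their two
    stages.\<close>
  have A_add: "x \<oplus> y \<in> A" if xy: "x \<in> A" "y \<in> A" for x y
  proof -
    obtain i j where "x \<in> augmentation_annihilator R U i" "y \<in> augmentation_annihilator R U j"
      using xy unfolding A_def by blast
    then have "x \<in> augmentation_annihilator R U (max i j)"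
        "y \<in> augmentation_annihilator R U (max i j)"
      using mono[of i "max i j"] mono[of j "max i j"] by auto
    then show ?thesis
      unfolding A_def using annihilator(3)[of x "max i j" y] by auto
  qed
  have BB: "\<zero> \<in> B" "\<And>x y. x \<in> B \<Longrightarrow> y \<in> B \<Longrightarrow> x \<oplus> y \<in> B" "\<And>x. x \<in> B \<Longrightarrow> \<ominus> x \<in> B"
      "\<And>u x. u \<in> U \<Longrightarrow> x \<in> B \<Longrightarrow> u \<otimes> x \<in> B"
    unfolding B_def using MM AA A_add actM by auto
  have BcR: "B \<subseteq> carrier R"
    using McR unfolding B_def by blast
  have subB: "subgroup B ?M"
  proof (rule M.subgroupI)
    show "inv\<^bsub>?M\<^esub> x \<in> B" if "x \<in> B" for x
      using that BB(3) add.m_inv_consistent[OF subM, of x] unfolding B_def by (simp add: a_inv_def)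
  qed (use BB B_def in auto)

  \<comment> \<open>\<open>c x\<close> is the coset of \<open>x\<close> modulo \<open>B\<close>.
    Below, \<open>act h\<close> multiplies every element of a coset by \<open>\<delta> h\<close>
    from the left.\<close>
  define c where "c = (\<lambda>x. (\<lambda>b. b \<oplus> x) ` B)"
  define C where "C = c ` M"
  have C_eq: "rcosets\<^bsub>?M\<^esub> B = C"
    unfolding C_def c_def RCOSETS_def r_coset_def by auto
  have finC: "finite C"
    using \<open>finite M\<close> unfolding C_def by simp
  define act where "act = (\<lambda>h. (`) (\<lambda>x. \<delta> h \<otimes> x))"
  have act_c: "act h (c x) = c (\<delta> h \<otimes> x)" if h: "h \<in> carrier H" and x: "x \<in> M" for h x
  proof
    have hU: "\<delta> h \<in> U" "\<delta> (inv\<^bsub>H\<^esub> h) \<in> U"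
      using h unfolding U_def by auto
    have xR: "x \<in> carrier R" using x McR by blast
    show "act h (c x) \<subseteq> c (\<delta> h \<otimes> x)"
      unfolding act_def c_def using hU U(1) xR BcR BB(4) by (auto simp: r_distr subset_iff)
    \<comment> \<open>The inverse of \<open>h\<close> provides the preimage: it moves the
      \<open>B\<close>-component \<open>b\<close> back to another element of
      \<open>B\<close>.\<close>
    show "c (\<delta> h \<otimes> x) \<subseteq> act h (c x)"
    proof
      fix y assume "y \<in> c (\<delta> h \<otimes> x)"
      then obtain b where b: "b \<in> B" "y = b \<oplus> \<delta> h \<otimes> x"
        unfolding c_def by blast
      have "\<delta> h \<otimes> (\<delta> (inv\<^bsub>H\<^esub> h) \<otimes> b) = b"
        using h b(1) BcR \<delta>(1) \<delta>(2)[of h "inv\<^bsub>H\<^esub> h", symmetric] \<delta>(3)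
        by (auto simp: m_assoc[symmetric] subset_iff)
      moreover have "\<delta> (inv\<^bsub>H\<^esub> h) \<otimes> b \<in> B"
        using BB(4) hU(2) b(1) by blast
      ultimately have "y = \<delta> h \<otimes> (\<delta> (inv\<^bsub>H\<^esub> h) \<otimes> b \<oplus> x)"
        using b(2) hU U(1) xR BcR by (auto simp: r_distr subset_iff)
      then show "y \<in> act h (c x)"
        unfolding act_def c_def using \<open>\<delta> (inv\<^bsub>H\<^esub> h) \<otimes> b \<in> B\<close> by blast
    qed
  qed
  have hM: "\<delta> h \<otimes> x \<in> M" if "h \<in> carrier H" "x \<in> M" for h x
    using that actM unfolding U_def by blast
  have c_zero: "c \<zero> = B"
    unfolding c_def using BcR by (auto simp: subset_iff)
  have c_mem: "x \<in> c x" if "x \<in> M" for x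
  proof -
    have "x = \<zero> \<oplus> x" using that McR by (auto simp: subset_iff)
    then show ?thesis unfolding c_def using BB(1) by blast
  qed

  have "M = B"
  proof (rule ccontr)
    assume "M \<noteq> B"
    \<comment> \<open>Lagrange makes the number of cosets a power of \<open>p\<close>. It is not 1
      because \<open>B\<close> is a proper subgroup, so \<open>p\<close> divides it.\<close>
    have card_prod: "card C * card B = p ^ N"
      using M.lagrange[OF subB] N unfolding C_eq order_def by simp
    have "card C \<noteq> 1"
    proof
      assume "card C = 1"
      then have "card B = card M"
        using card_prod N by simp
      then show False
        using card_subset_eq[OF \<open>finite M\<close>, of B] \<open>M \<noteq> B\<close> unfolding B_def by auto
    qed
    moreover obtain i where "card C = p ^ i"
      using card_prod divides_primepow_nat[OF p] by (metis dvd_triv_left)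
    ultimately have "p dvd card C"
      by (cases i) auto
    have "\<exists>K\<in>C. K \<noteq> B \<and> (\<forall>h\<in>carrier H. act h K = K)"
    \<comment> \<open>The known fixed point is the coset \<open>B\<close> itself.\<close>
    proof (rule H.exists_other_fixed_point[OF p ord finC \<open>p dvd card C\<close>])
      show "act h K \<in> C" if "h \<in> carrier H" "K \<in> C" for h K
        using that act_c hM unfolding C_def by auto
      show "act \<one>\<^bsub>H\<^esub> K = K" if "K \<in> C" for K
        using that act_c \<delta>(3) McR unfolding C_def by (auto simp: subset_iff)
      show "act (g \<otimes>\<^bsub>H\<^esub> h) K = act g (act h K)"
        if "g \<in> carrier H" "h \<in> carrier H" "K \<in> C" for g h K
        using that act_c hM \<delta>(1,2) McR unfolding C_def by (auto simp: subset_iff m_assoc)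
      show "B \<in> C"
        using c_zero MM(1) unfolding C_def by blast
      show "act h B = B" if "h \<in> carrier H" for h
        using that act_c[OF that MM(1)] c_zero \<delta>(1) by simp
    qed
    then obtain K where K: "K \<in> C" "K \<noteq> B" "\<And>h. h \<in> carrier H \<Longrightarrow> act h K = K"
      by blast
    then obtain x where "x \<in> M" "K = c x"
      unfolding C_def by blast
    then have x: "x \<in> M" "c x \<noteq> B" "\<And>h. h \<in> carrier H \<Longrightarrow> c (\<delta> h \<otimes> x) = c x"
      using K act_c by metis+
    have xR: "x \<in> carrier R" using x(1) McR by blast
    \<comment> \<open>A fixed coset means that \<open>(h - 1) x\<close> lies in \<open>B\<close>, at
      a stage that depends on \<open>h\<close>. As \<open>H\<close> is finite, the maximum of these
      stages works for all \<open>h\<close>, which puts \<open>x\<close> one stage higher and so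
      into \<open>B\<close>.\<close>
    have "\<exists>j. (\<delta> h \<ominus> \<one>) \<otimes> x \<in> augmentation_annihilator R U j" if h: "h \<in> carrier H" for h
    proof -
      have "\<delta> h \<otimes> x \<in> c x"
        using c_mem[OF hM[OF h x(1)]] x(3)[OF h] by simp
      then obtain b where b: "b \<in> B" "\<delta> h \<otimes> x = b \<oplus> x"
        unfolding c_def by blast
      have "(\<delta> h \<ominus> \<one>) \<otimes> x = \<delta> h \<otimes> x \<ominus> x"
        using h \<delta>(1) xR by (simp add: minus_eq l_distr l_minus)
      also have "\<dots> = b"
        using b BcR xR by (auto simp: minus_eq a_assoc r_neg subset_iff)
      finally show ?thesis
        using b(1) unfolding B_def A_def by auto
    qed
    then obtain J where J: "\<And>h. h \<in> carrier H \<Longrightarrow>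
        (\<delta> h \<ominus> \<one>) \<otimes> x \<in> augmentation_annihilator R U (J h)"
      by metis
    have "J h \<le> Max (J ` carrier H)" if "h \<in> carrier H" for h
      using finH that by simp
    then have "(\<delta> h \<ominus> \<one>) \<otimes> x \<in> augmentation_annihilator R U (Max (J ` carrier H))"
      if "h \<in> carrier H" for h
      using J[OF that] mono that by blast
    then have "x \<in> augmentation_annihilator R U (Suc (Max (J ` carrier H)))"
      using xR unfolding U_def by auto
    then have xB: "x \<in> B"
      using x(1) unfolding A_def B_def by blast
    have "c x = B"
    proof
      show "c x \<subseteq> B" unfolding c_def using BB(2) xB by blast
      show "B \<subseteq> c x"
      proof
        fix b assume b: "b \<in> B"
        then have "b = (b \<oplus> \<ominus> x) \<oplus> x"
          using BcR xR by (auto simp: a_assoc l_neg subset_iff)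
        then show "b \<in> c x"
          unfolding c_def using BB(2)[OF b BB(3)[OF xB]] by blast
      qed
    qed
    then show False using x(2) by simp
  qed
  moreover have "\<one> \<in> M"
    unfolding M_def using \<delta>(3) H.one_closed by (metis U_def generate.incl imageI)
  ultimately show ?thesis
    unfolding B_def A_def U_def by blast
qed

text \<open>Multiplication by \<open>f\<close> lowers the stage by one: each \<open>u i - 1\<close>
  does so, and each \<open>r i\<close> commutes with \<open>U\<close> and keeps the stage. Hence
  \<open>f ^ j\<close> kills stage \<open>j\<close>, and when that stage contains 1 it follows that
  \<open>f ^ j = 0\<close>.\<close>

lemma nilpotent_of_mem_augmentation_annihilator:
  assumes U: "U \<subseteq> carrier R" and S: "finite S"
    and f: "f = (\<Oplus>i\<in>S. r i \<otimes> (u i \<ominus> \<one>))"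
    and u: "\<And>i. i \<in> S \<Longrightarrow> u i \<in> U"
    and r: "\<And>i. i \<in> S \<Longrightarrow> r i \<in> carrier R"
      "\<And>i v. i \<in> S \<Longrightarrow> v \<in> U \<Longrightarrow> v \<otimes> r i = r i \<otimes> v"
    and one: "\<one> \<in> augmentation_annihilator R U j"
  shows "f \<in> nilpotents R"
proof -
  have uR: "u i \<in> carrier R" if "i \<in> S" for i
    using u U that by blast
  have fR: "f \<in> carrier R"
    unfolding f using r uR by (simp add: Pi_def)
  have step: "f \<otimes> x \<in> augmentation_annihilator R U j"
    if x: "x \<in> augmentation_annihilator R U (Suc j)" for x j
  proof -
    have xR: "x \<in> carrier R" using x by simp
    have *: "r i \<otimes> ((u i \<ominus> \<one>) \<otimes> x) \<in> augmentation_annihilator R U j" if "i \<in> S" for i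
      using that x u by (intro augmentation_annihilator_mult[OF U r(1)[OF that] r(2)[OF that]]) auto
    have eq: "f \<otimes> x = (\<Oplus>i\<in>S. r i \<otimes> ((u i \<ominus> \<one>) \<otimes> x))"
      unfolding f using S r(1) uR xR
      by (simp add: finsum_ldistr Pi_def m_assoc cong: finsum_cong)
    have "(\<Oplus>i\<in>T. r i \<otimes> ((u i \<ominus> \<one>) \<otimes> x)) \<in> augmentation_annihilator R U j"
      if "finite T" "T \<subseteq> S" for T
      using that
    proof (induction T)
      case empty
      then show ?case by (simp add: augmentation_annihilator_zero[OF U])
    next
      case (insert i T)
      then show ?case
        using * r(1) uR xR by (subst finsum_insert) (auto intro: augmentation_annihilator_add[OF U])
    qed
    then show ?thesis
      using S eq by simp
  qed
  have "f [^] j \<otimes> x = \<zero>" if "x \<in> augmentation_annihilator R U j" for x j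
    using that
  proof (induction j arbitrary: x)
    case 0
    then show ?case by simp
  next
    case (Suc j)
    then have "f [^] j \<otimes> (f \<otimes> x) = \<zero>"
      using step by blast
    then show ?case
      using fR Suc.prems by (simp add: m_assoc)
  qed
  then have "f [^] j = \<zero>"
    using one fR by fastforce
  then show ?thesis
    using fR by (rule nilpotentsI[rotated])
qed

end

section \<open>The group ring and its augmentation\<close>

lemma (in abelian_monoid) finsum_swap:
  assumes "finite A" "finite B" "\<And>i j. i \<in> A \<Longrightarrow> j \<in> B \<Longrightarrow> f i j \<in> carrier G"
  shows "(\<Oplus>i\<in>A. \<Oplus>j\<in>B. f i j) = (\<Oplus>j\<in>B. \<Oplus>i\<in>A. f i j)"
  using assms(1,3)
proof (induction A)
  case (insert a A)
  have "(\<Oplus>i\<in>insert a A. \<Oplus>j\<in>B. f i j) = (\<Oplus>j\<in>B. f a j) \<oplus> (\<Oplus>j\<in>B. \<Oplus>i\<in>A. f i j)"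
    using insert by (subst finsum_insert) (auto simp: Pi_def intro!: finsum_closed)
  also have "\<dots> = (\<Oplus>j\<in>B. f a j \<oplus> (\<Oplus>i\<in>A. f i j))"
    using insert by (subst finsum_addf) (auto simp: Pi_def intro!: finsum_closed)
  also have "\<dots> = (\<Oplus>j\<in>B. \<Oplus>i\<in>insert a A. f i j)"
    using insert by (intro finsum_cong') (auto simp: Pi_def intro!: finsum_closed)
  finally show ?case .
qed simp

locale group_algebra = R: ring R + G: group G
  for R :: "('a, 'm) ring_scheme" (structure) and G :: "('g, 'n) monoid_scheme" (structure)
begin

abbreviation RG :: "('g \<Rightarrow> 'a) ring" where
  "RG \<equiv> group_ring R G"

definition supp :: "('g \<Rightarrow> 'a) \<Rightarrow> 'g set" where
  "supp f = {x. f x \<noteq> \<zero>}"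

text \<open>The monomial \<open>r y\<close>. The case \<open>r = 1\<close> gives the group elements
  inside the group ring, and the case where \<open>y\<close> is the identity gives the
  scalars.\<close>

definition single :: "'a \<Rightarrow> 'g \<Rightarrow> 'g \<Rightarrow> 'a" where
  "single r y = (\<lambda>x. if x = y then r else \<zero>)"

definition aug :: "('g \<Rightarrow> 'a) \<Rightarrow> 'a" where
  "aug f = finsum R f (supp f)"

lemma carrier_RG: "carrier RG = {f. range f \<subseteq> carrier R \<and> supp f \<subseteq> carrier G \<and> finite (supp f)}"
  by (simp add: group_ring_def group_ring_carrier_def supp_def)

lemma one_RG: "\<one>\<^bsub>RG\<^esub> = single \<one> \<one>\<^bsub>G\<^esub>"
  by (simp add: group_ring_def single_def)

lemma zero_RG: "\<zero>\<^bsub>RG\<^esub> = (\<lambda>x. \<zero>)"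
  by (simp add: group_ring_def)

lemma add_RG: "f \<oplus>\<^bsub>RG\<^esub> g = (\<lambda>x. f x \<oplus> g x)"
  by (simp add: group_ring_def)

lemma RG_closed: "f \<in> carrier RG \<Longrightarrow> f x \<in> carrier R"
  unfolding carrier_RG by auto

lemma RG_outside: "f \<in> carrier RG \<Longrightarrow> x \<notin> carrier G \<Longrightarrow> f x = \<zero>"
  unfolding carrier_RG supp_def by auto

lemma RG_supp: "f \<in> carrier RG \<Longrightarrow> finite (supp f)" "f \<in> carrier RG \<Longrightarrow> supp f \<subseteq> carrier G"
  unfolding carrier_RG by auto

lemma RG_eqI:
  assumes "f \<in> carrier RG" "g \<in> carrier RG" "\<And>x. x \<in> carrier G \<Longrightarrow> f x = g x"
  shows "f = g"
  using assms RG_outside by (intro ext) metis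

lemma not_supp: "x \<notin> supp f \<Longrightarrow> f x = \<zero>"
  unfolding supp_def by simp

lemma single_closed: "r \<in> carrier R \<Longrightarrow> y \<in> carrier G \<Longrightarrow> single r y \<in> carrier RG"
proof -
  assume "r \<in> carrier R" "y \<in> carrier G"
  moreover have "supp (single r y) \<subseteq> {y}"
    unfolding supp_def single_def by auto
  ultimately show ?thesis
    unfolding carrier_RG by (auto simp: single_def intro: finite_subset)
qed

text \<open>A pair with \<open>y z = x\<close> is determined by \<open>y\<close>, and indices in
  \<open>T\<close> without a contributing pair add zero. Allowing any finite \<open>T\<close> that
  contains the support lets products with different left factors be expanded over one index
  set.\<close>

lemma mult_RG_apply:
  assumes f: "f \<in> carrier RG" and g: "g \<in> carrier RG" and x: "x \<in> carrier G"
    and T: "finite T" "supp f \<subseteq> T" "T \<subseteq> carrier G"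
  shows "(f \<otimes>\<^bsub>RG\<^esub> g) x = (\<Oplus>y\<in>T. f y \<otimes> g (inv\<^bsub>G\<^esub> y \<otimes>\<^bsub>G\<^esub> x))"
proof -
  define P where "P = {(y, z). f y \<noteq> \<zero> \<and> g z \<noteq> \<zero> \<and> y \<otimes>\<^bsub>G\<^esub> z = x}"
  define T' where "T' = {y \<in> T. f y \<noteq> \<zero> \<and> g (inv\<^bsub>G\<^esub> y \<otimes>\<^bsub>G\<^esub> x) \<noteq> \<zero>}"
  define h where "h = (\<lambda>y. (y, inv\<^bsub>G\<^esub> y \<otimes>\<^bsub>G\<^esub> x))"
  have cl: "f y \<otimes> g z \<in> carrier R" for y z
    using RG_closed[OF f] RG_closed[OF g] by blast
  have P_eq: "P = h ` T'"
  proof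
    show "P \<subseteq> h ` T'"
    proof
      fix q assume "q \<in> P"
      then obtain y z where q: "q = (y, z)" "f y \<noteq> \<zero>" "g z \<noteq> \<zero>" "y \<otimes>\<^bsub>G\<^esub> z = x"
        unfolding P_def by blast
      have yz: "y \<in> carrier G" "z \<in> carrier G"
        using RG_outside[OF f] RG_outside[OF g] q by blast+
      have z: "z = inv\<^bsub>G\<^esub> y \<otimes>\<^bsub>G\<^esub> x"
        using yz q(4) by (simp add: G.m_assoc[symmetric] flip: q(4))
      then have "y \<in> T'"
        unfolding T'_def using q T(2) by (auto simp: supp_def)
      then show "q \<in> h ` T'"
        unfolding h_def using z q(1) by blast
    qed
    show "h ` T' \<subseteq> P"
      unfolding P_def T'_def h_def using x T(3) by (auto simp: subset_iff G.m_assoc[symmetric])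
  qed
  have "(f \<otimes>\<^bsub>RG\<^esub> g) x = (\<Oplus>q\<in>P. case q of (y, z) \<Rightarrow> f y \<otimes> g z)"
    by (simp add: group_ring_def P_def)
  also have "\<dots> = (\<Oplus>y\<in>T'. case h y of (y, z) \<Rightarrow> f y \<otimes> g z)"
    unfolding P_eq by (rule R.finsum_reindex) (auto simp: h_def cl inj_on_def)
  also have "\<dots> = (\<Oplus>y\<in>T. f y \<otimes> g (inv\<^bsub>G\<^esub> y \<otimes>\<^bsub>G\<^esub> x))"
    using T(1) cl RG_closed[OF f] RG_closed[OF g]
    by (intro R.add.finprod_mono_neutral_cong_left) (auto simp: T'_def h_def)
  finally show ?thesis .
qed

lemma mult_RG_supp: "supp (f \<otimes>\<^bsub>RG\<^esub> g) \<subseteq> (\<lambda>(y, z). y \<otimes>\<^bsub>G\<^esub> z) ` (supp f \<times> supp g)"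
proof
  fix x assume x: "x \<in> supp (f \<otimes>\<^bsub>RG\<^esub> g)"
  show "x \<in> (\<lambda>(y, z). y \<otimes>\<^bsub>G\<^esub> z) ` (supp f \<times> supp g)"
  proof (rule ccontr)
    assume "\<not> ?thesis"
    then have "{(y, z). f y \<noteq> \<zero> \<and> g z \<noteq> \<zero> \<and> y \<otimes>\<^bsub>G\<^esub> z = x} = {}"
      unfolding supp_def by force
    moreover have "(f \<otimes>\<^bsub>RG\<^esub> g) x = finsum R (\<lambda>(y, z). f y \<otimes> g z)
        {(y, z). f y \<noteq> \<zero> \<and> g z \<noteq> \<zero> \<and> y \<otimes>\<^bsub>G\<^esub> z = x}"
      by (simp add: group_ring_def)
    ultimately have "(f \<otimes>\<^bsub>RG\<^esub> g) x = \<zero>"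
      by (simp only: R.finsum_empty)
    then show False
      using x by (simp add: supp_def)
  qed
qed

lemma mult_RG_closed:
  assumes f: "f \<in> carrier RG" and g: "g \<in> carrier RG"
  shows "f \<otimes>\<^bsub>RG\<^esub> g \<in> carrier RG"
proof -
  have "(\<lambda>(y, z). y \<otimes>\<^bsub>G\<^esub> z) ` (supp f \<times> supp g) \<subseteq> carrier G"
    using RG_supp(2)[OF f] RG_supp(2)[OF g] by auto
  then have sub: "supp (f \<otimes>\<^bsub>RG\<^esub> g) \<subseteq> carrier G"
    using mult_RG_supp by blast
  have "(f \<otimes>\<^bsub>RG\<^esub> g) x \<in> carrier R" for x
  proof (cases "x \<in> carrier G")
    case True
    then show ?thesis
      using mult_RG_apply[OF f g True RG_supp(1)[OF f] subset_refl RG_supp(2)[OF f]]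
        RG_closed[OF f] RG_closed[OF g] by simp
  next
    case False
    then show ?thesis
      using sub not_supp[of x] by force
  qed
  moreover have "finite (supp (f \<otimes>\<^bsub>RG\<^esub> g))"
    using RG_supp(1)[OF f] RG_supp(1)[OF g] by (intro finite_subset[OF mult_RG_supp]) simp
  ultimately show ?thesis
    unfolding carrier_RG using sub by blast
qed

lemma add_RG_closed:
  assumes f: "f \<in> carrier RG" and g: "g \<in> carrier RG"
  shows "f \<oplus>\<^bsub>RG\<^esub> g \<in> carrier RG"
proof -
  have sub: "supp (f \<oplus>\<^bsub>RG\<^esub> g) \<subseteq> supp f \<union> supp g"
    unfolding supp_def add_RG by auto
  moreover have "finite (supp (f \<oplus>\<^bsub>RG\<^esub> g))"
    using RG_supp[OF f] RG_supp[OF g] by (intro finite_subset[OF sub]) simp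
  moreover have "range (f \<oplus>\<^bsub>RG\<^esub> g) \<subseteq> carrier R"
    using RG_closed[OF f] RG_closed[OF g] by (auto simp: add_RG)
  ultimately show ?thesis
    using RG_supp(2)[OF f] RG_supp(2)[OF g] unfolding carrier_RG by blast
qed

lemma single_mult_apply:
  assumes "f \<in> carrier RG" "r \<in> carrier R" "y \<in> carrier G" "x \<in> carrier G"
  shows "(single r y \<otimes>\<^bsub>RG\<^esub> f) x = r \<otimes> f (inv\<^bsub>G\<^esub> y \<otimes>\<^bsub>G\<^esub> x)"
proof -
  have "(single r y \<otimes>\<^bsub>RG\<^esub> f) x = (\<Oplus>z\<in>{y}. single r y z \<otimes> f (inv\<^bsub>G\<^esub> z \<otimes>\<^bsub>G\<^esub> x))"
    using assms
    by (intro mult_RG_apply single_closed) (auto simp: supp_def single_def split: if_splits)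
  also have "\<dots> = r \<otimes> f (inv\<^bsub>G\<^esub> y \<otimes>\<^bsub>G\<^esub> x)"
    using assms RG_closed[OF assms(1)] by (simp add: single_def)
  finally show ?thesis .
qed

lemma mult_single_apply:
  assumes f: "f \<in> carrier RG" and c: "r \<in> carrier R" "y \<in> carrier G" "x \<in> carrier G"
  shows "(f \<otimes>\<^bsub>RG\<^esub> single r y) x = f (x \<otimes>\<^bsub>G\<^esub> inv\<^bsub>G\<^esub> y) \<otimes> r"
proof -
  let ?i = "x \<otimes>\<^bsub>G\<^esub> inv\<^bsub>G\<^esub> y"
  \<comment> \<open>The only index that contributes may lie outside the support of \<open>f\<close>,
    so it is added.\<close>
  let ?T = "insert ?i (supp f)"
  have T: "finite ?T" "?T \<subseteq> carrier G"
    using RG_supp[OF f] c by auto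
  have iff: "inv\<^bsub>G\<^esub> z \<otimes>\<^bsub>G\<^esub> x = y \<longleftrightarrow> ?i = z" if "z \<in> carrier G" for z
    using that c by (metis G.inv_closed G.inv_solve_left G.inv_solve_right)
  have "(f \<otimes>\<^bsub>RG\<^esub> single r y) x
      = (\<Oplus>z\<in>?T. f z \<otimes> single r y (inv\<^bsub>G\<^esub> z \<otimes>\<^bsub>G\<^esub> x))"
    using f c T by (intro mult_RG_apply) (auto simp: single_closed)
  also have "\<dots> = (\<Oplus>z\<in>?T. if ?i = z then f z \<otimes> r else \<zero>)"
    using iff T(2) c(1) RG_closed[OF f] by (intro R.finsum_cong') (auto simp: single_def)
  also have "\<dots> = f ?i \<otimes> r"
    using T(1) c(1) RG_closed[OF f] by (intro R.finsum_singleton) auto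
  finally show ?thesis .
qed

text \<open>Both \<open>(f g) h\<close> and the augmentation of \<open>f g\<close> are computed by summing over this product set,
  which after translation by \<open>y\<inverse>\<close> covers the support of \<open>g\<close>.\<close>

lemma translate_product_set:
  assumes f: "f \<in> carrier RG" and g: "g \<in> carrier RG" and y: "y \<in> supp f"
    and T: "T = (\<lambda>(y, z). y \<otimes>\<^bsub>G\<^esub> z) ` (supp f \<times> supp g)"
  shows "finite T" "T \<subseteq> carrier G"
    "inj_on (\<lambda>z. inv\<^bsub>G\<^esub> y \<otimes>\<^bsub>G\<^esub> z) T" "supp g \<subseteq> (\<lambda>z. inv\<^bsub>G\<^esub> y \<otimes>\<^bsub>G\<^esub> z) ` T"
    "(\<lambda>z. inv\<^bsub>G\<^esub> y \<otimes>\<^bsub>G\<^esub> z) ` T \<subseteq> carrier G"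
proof -
  show "finite T"
    using RG_supp(1)[OF f] RG_supp(1)[OF g] unfolding T by simp
  show TG: "T \<subseteq> carrier G"
    using RG_supp(2)[OF f] RG_supp(2)[OF g] unfolding T by auto
  have yG: "y \<in> carrier G"
    using RG_supp(2)[OF f] y by blast
  show "inj_on (\<lambda>z. inv\<^bsub>G\<^esub> y \<otimes>\<^bsub>G\<^esub> z) T"
    using TG yG by (auto simp: inj_on_def subset_iff)
  show "(\<lambda>z. inv\<^bsub>G\<^esub> y \<otimes>\<^bsub>G\<^esub> z) ` T \<subseteq> carrier G"
    using TG yG by auto
  show "supp g \<subseteq> (\<lambda>z. inv\<^bsub>G\<^esub> y \<otimes>\<^bsub>G\<^esub> z) ` T"
  proof
    fix w assume w: "w \<in> supp g"
    then have "w = inv\<^bsub>G\<^esub> y \<otimes>\<^bsub>G\<^esub> (y \<otimes>\<^bsub>G\<^esub> w)"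
      using RG_supp(2)[OF g] yG by (auto simp: G.m_assoc[symmetric])
    moreover have "y \<otimes>\<^bsub>G\<^esub> w \<in> T"
      unfolding T using w y by force
    ultimately show "w \<in> (\<lambda>z. inv\<^bsub>G\<^esub> y \<otimes>\<^bsub>G\<^esub> z) ` T" by blast
  qed
qed

text \<open>At \<open>x\<close> both sides equal the double sum of
  \<open>f(y) g(y^-1 z) h(z^-1 x)\<close> over \<open>y\<close> in the support of \<open>f\<close>
  and \<open>z\<close> in \<open>T\<close>, taken in the two orders of summation.\<close>

lemma mult_RG_assoc:
  assumes f: "f \<in> carrier RG" and g: "g \<in> carrier RG" and h: "h \<in> carrier RG"
  shows "(f \<otimes>\<^bsub>RG\<^esub> g) \<otimes>\<^bsub>RG\<^esub> h = f \<otimes>\<^bsub>RG\<^esub> (g \<otimes>\<^bsub>RG\<^esub> h)"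
proof (rule RG_eqI)
  show "(f \<otimes>\<^bsub>RG\<^esub> g) \<otimes>\<^bsub>RG\<^esub> h \<in> carrier RG" "f \<otimes>\<^bsub>RG\<^esub> (g \<otimes>\<^bsub>RG\<^esub> h) \<in> carrier RG"
    using assms mult_RG_closed by auto
  fix x assume x: "x \<in> carrier G"
  define T where T: "T = (\<lambda>(y, z). y \<otimes>\<^bsub>G\<^esub> z) ` (supp f \<times> supp g)"
  have TG: "finite T" "T \<subseteq> carrier G"
    using RG_supp[OF f] RG_supp[OF g] unfolding T by auto
  note F = RG_supp[OF f]
  note fc = RG_closed[OF f] and gc = RG_closed[OF g] and hc = RG_closed[OF h]
  have inner: "(g \<otimes>\<^bsub>RG\<^esub> h) (inv\<^bsub>G\<^esub> y \<otimes>\<^bsub>G\<^esub> x)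
      = (\<Oplus>z\<in>T. g (inv\<^bsub>G\<^esub> y \<otimes>\<^bsub>G\<^esub> z) \<otimes> h (inv\<^bsub>G\<^esub> z \<otimes>\<^bsub>G\<^esub> x))" if y: "y \<in> supp f" for y
  proof -
    note tr = translate_product_set[OF f g y T]
    have yG: "y \<in> carrier G" using F(2) y by blast
    \<comment> \<open>The translate of \<open>T\<close> contains the support of \<open>g\<close>, so
      it may serve as index set; then \<open>w = y^-1 z\<close> is substituted.\<close>
    have "(g \<otimes>\<^bsub>RG\<^esub> h) (inv\<^bsub>G\<^esub> y \<otimes>\<^bsub>G\<^esub> x) = (\<Oplus>w\<in>(\<lambda>z. inv\<^bsub>G\<^esub> y \<otimes>\<^bsub>G\<^esub> z) ` T.
        g w \<otimes> h (inv\<^bsub>G\<^esub> w \<otimes>\<^bsub>G\<^esub> (inv\<^bsub>G\<^esub> y \<otimes>\<^bsub>G\<^esub> x)))"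
      using tr x yG g h by (intro mult_RG_apply) auto
    also have "\<dots> = (\<Oplus>z\<in>T. g (inv\<^bsub>G\<^esub> y \<otimes>\<^bsub>G\<^esub> z) \<otimes>
        h (inv\<^bsub>G\<^esub> (inv\<^bsub>G\<^esub> y \<otimes>\<^bsub>G\<^esub> z) \<otimes>\<^bsub>G\<^esub> (inv\<^bsub>G\<^esub> y \<otimes>\<^bsub>G\<^esub> x)))"
      using tr(3) gc hc by (intro R.finsum_reindex) auto
    also have "\<dots> = (\<Oplus>z\<in>T. g (inv\<^bsub>G\<^esub> y \<otimes>\<^bsub>G\<^esub> z) \<otimes> h (inv\<^bsub>G\<^esub> z \<otimes>\<^bsub>G\<^esub> x))"
    proof (intro R.finsum_cong' refl)
      fix z assume "z \<in> T"
      then have zG: "z \<in> carrier G" using TG by blast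
      have "inv\<^bsub>G\<^esub> (inv\<^bsub>G\<^esub> y \<otimes>\<^bsub>G\<^esub> z) \<otimes>\<^bsub>G\<^esub> (inv\<^bsub>G\<^esub> y \<otimes>\<^bsub>G\<^esub> x)
          = inv\<^bsub>G\<^esub> z \<otimes>\<^bsub>G\<^esub> ((y \<otimes>\<^bsub>G\<^esub> inv\<^bsub>G\<^esub> y) \<otimes>\<^bsub>G\<^esub> x)"
        using zG yG x G.m_assoc[of y "inv\<^bsub>G\<^esub> y" x] by (simp add: G.inv_mult_group G.m_assoc)
      then show "g (inv\<^bsub>G\<^esub> y \<otimes>\<^bsub>G\<^esub> z) \<otimes>
            h (inv\<^bsub>G\<^esub> (inv\<^bsub>G\<^esub> y \<otimes>\<^bsub>G\<^esub> z) \<otimes>\<^bsub>G\<^esub> (inv\<^bsub>G\<^esub> y \<otimes>\<^bsub>G\<^esub> x))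
          = g (inv\<^bsub>G\<^esub> y \<otimes>\<^bsub>G\<^esub> z) \<otimes> h (inv\<^bsub>G\<^esub> z \<otimes>\<^bsub>G\<^esub> x)"
        using yG x by simp
    qed (use gc hc in auto)
    finally show ?thesis .
  qed
  have "((f \<otimes>\<^bsub>RG\<^esub> g) \<otimes>\<^bsub>RG\<^esub> h) x
      = (\<Oplus>z\<in>T. (f \<otimes>\<^bsub>RG\<^esub> g) z \<otimes> h (inv\<^bsub>G\<^esub> z \<otimes>\<^bsub>G\<^esub> x))"
    using assms x TG mult_RG_supp[of f g] by (intro mult_RG_apply) (auto simp: mult_RG_closed T)
  also have "\<dots> = (\<Oplus>z\<in>T. \<Oplus>y\<in>supp f.
      f y \<otimes> (g (inv\<^bsub>G\<^esub> y \<otimes>\<^bsub>G\<^esub> z) \<otimes> h (inv\<^bsub>G\<^esub> z \<otimes>\<^bsub>G\<^esub> x)))"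
  proof (intro R.finsum_cong' refl)
    fix z assume "z \<in> T"
    then have "(f \<otimes>\<^bsub>RG\<^esub> g) z = (\<Oplus>y\<in>supp f. f y \<otimes> g (inv\<^bsub>G\<^esub> y \<otimes>\<^bsub>G\<^esub> z))"
      using f g F TG by (intro mult_RG_apply) auto
    then show "(f \<otimes>\<^bsub>RG\<^esub> g) z \<otimes> h (inv\<^bsub>G\<^esub> z \<otimes>\<^bsub>G\<^esub> x)
        = (\<Oplus>y\<in>supp f. f y \<otimes> (g (inv\<^bsub>G\<^esub> y \<otimes>\<^bsub>G\<^esub> z) \<otimes> h (inv\<^bsub>G\<^esub> z \<otimes>\<^bsub>G\<^esub> x)))"
      using F fc gc hc by (simp add: R.finsum_ldistr Pi_def R.m_assoc)
  qed (use fc gc hc in auto)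
  also have "\<dots> = (\<Oplus>y\<in>supp f. \<Oplus>z\<in>T.
      f y \<otimes> (g (inv\<^bsub>G\<^esub> y \<otimes>\<^bsub>G\<^esub> z) \<otimes> h (inv\<^bsub>G\<^esub> z \<otimes>\<^bsub>G\<^esub> x)))"
    using F TG fc gc hc by (intro R.finsum_swap) auto
  also have "\<dots> = (\<Oplus>y\<in>supp f. f y \<otimes> (g \<otimes>\<^bsub>RG\<^esub> h) (inv\<^bsub>G\<^esub> y \<otimes>\<^bsub>G\<^esub> x))"
    using F TG fc gc hc by (intro R.finsum_cong' refl) (auto simp: inner R.finsum_rdistr Pi_def)
  also have "\<dots> = (f \<otimes>\<^bsub>RG\<^esub> (g \<otimes>\<^bsub>RG\<^esub> h)) x"
    using assms F x by (intro mult_RG_apply[symmetric]) (auto simp: mult_RG_closed)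
  finally show "((f \<otimes>\<^bsub>RG\<^esub> g) \<otimes>\<^bsub>RG\<^esub> h) x = (f \<otimes>\<^bsub>RG\<^esub> (g \<otimes>\<^bsub>RG\<^esub> h)) x" .
qed

lemma ring_RG: "ring RG"
proof (intro ringI abelian_groupI monoidI)
  show zero: "\<zero>\<^bsub>RG\<^esub> \<in> carrier RG"
    unfolding carrier_RG supp_def zero_RG by auto
  show one: "\<one>\<^bsub>RG\<^esub> \<in> carrier RG"
    unfolding one_RG by (rule single_closed) auto
  show "\<one>\<^bsub>RG\<^esub> \<otimes>\<^bsub>RG\<^esub> f = f" if f: "f \<in> carrier RG" for f
    using f one mult_RG_closed RG_closed[OF f]
    by (intro RG_eqI) (auto simp: one_RG single_mult_apply)
  show "f \<otimes>\<^bsub>RG\<^esub> \<one>\<^bsub>RG\<^esub> = f" if f: "f \<in> carrier RG" for f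
    using f one mult_RG_closed RG_closed[OF f]
    by (intro RG_eqI) (auto simp: one_RG mult_single_apply)
  show "\<zero>\<^bsub>RG\<^esub> \<oplus>\<^bsub>RG\<^esub> f = f" if f: "f \<in> carrier RG" for f
    using RG_closed[OF f] by (simp add: add_RG zero_RG)
  show "\<exists>g\<in>carrier RG. g \<oplus>\<^bsub>RG\<^esub> f = \<zero>\<^bsub>RG\<^esub>" if f: "f \<in> carrier RG" for f
  proof (intro bexI)
    have "supp (\<lambda>x. \<ominus> f x) \<subseteq> supp f"
      unfolding supp_def by auto
    then show "(\<lambda>x. \<ominus> f x) \<in> carrier RG"
      using RG_supp[OF f] RG_closed[OF f] finite_subset unfolding carrier_RG by auto
    show "(\<lambda>x. \<ominus> f x) \<oplus>\<^bsub>RG\<^esub> f = \<zero>\<^bsub>RG\<^esub>"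
      using RG_closed[OF f] by (simp add: add_RG zero_RG R.l_neg)
  qed
  fix f g h assume f: "f \<in> carrier RG" and g: "g \<in> carrier RG"
  note fc = RG_closed[OF f] and gc = RG_closed[OF g]
  show "f \<oplus>\<^bsub>RG\<^esub> g = g \<oplus>\<^bsub>RG\<^esub> f"
    using fc gc by (simp add: add_RG R.a_comm)
  assume h: "h \<in> carrier RG"
  note hc = RG_closed[OF h]
  show "f \<oplus>\<^bsub>RG\<^esub> g \<oplus>\<^bsub>RG\<^esub> h = f \<oplus>\<^bsub>RG\<^esub> (g \<oplus>\<^bsub>RG\<^esub> h)"
    using fc gc hc by (simp add: add_RG R.a_assoc)
  show "(f \<oplus>\<^bsub>RG\<^esub> g) \<otimes>\<^bsub>RG\<^esub> h = f \<otimes>\<^bsub>RG\<^esub> h \<oplus>\<^bsub>RG\<^esub> g \<otimes>\<^bsub>RG\<^esub> h"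
  proof (rule RG_eqI)
    fix x assume x: "x \<in> carrier G"
    let ?T = "supp f \<union> supp g"
    have T: "finite ?T" "?T \<subseteq> carrier G"
      using RG_supp[OF f] RG_supp[OF g] by auto
    have "supp (f \<oplus>\<^bsub>RG\<^esub> g) \<subseteq> ?T"
      unfolding supp_def add_RG by auto
    then have "((f \<oplus>\<^bsub>RG\<^esub> g) \<otimes>\<^bsub>RG\<^esub> h) x
        = (\<Oplus>y\<in>?T. (f \<oplus>\<^bsub>RG\<^esub> g) y \<otimes> h (inv\<^bsub>G\<^esub> y \<otimes>\<^bsub>G\<^esub> x))"
      using T x f g h by (intro mult_RG_apply add_RG_closed)
    also have "\<dots> = (\<Oplus>y\<in>?T. f y \<otimes> h (inv\<^bsub>G\<^esub> y \<otimes>\<^bsub>G\<^esub> x))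
        \<oplus> (\<Oplus>y\<in>?T. g y \<otimes> h (inv\<^bsub>G\<^esub> y \<otimes>\<^bsub>G\<^esub> x))"
      using fc gc hc by (simp add: add_RG R.l_distr R.finsum_addf Pi_def)
    also have "\<dots> = (f \<otimes>\<^bsub>RG\<^esub> h \<oplus>\<^bsub>RG\<^esub> g \<otimes>\<^bsub>RG\<^esub> h) x"
      unfolding add_RG using T x f g h by (subst (1 2) mult_RG_apply[where T = ?T]) auto
    finally show "((f \<oplus>\<^bsub>RG\<^esub> g) \<otimes>\<^bsub>RG\<^esub> h) x = (f \<otimes>\<^bsub>RG\<^esub> h \<oplus>\<^bsub>RG\<^esub> g \<otimes>\<^bsub>RG\<^esub> h) x" .
  qed (use f g h mult_RG_closed add_RG_closed in auto)
  show "h \<otimes>\<^bsub>RG\<^esub> (f \<oplus>\<^bsub>RG\<^esub> g) = h \<otimes>\<^bsub>RG\<^esub> f \<oplus>\<^bsub>RG\<^esub> h \<otimes>\<^bsub>RG\<^esub> g"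
  proof (rule RG_eqI)
    fix x assume x: "x \<in> carrier G"
    let ?T = "supp h"
    have T: "finite ?T" "?T \<subseteq> carrier G"
      using RG_supp[OF h] by auto
    have "(h \<otimes>\<^bsub>RG\<^esub> (f \<oplus>\<^bsub>RG\<^esub> g)) x
        = (\<Oplus>y\<in>?T. h y \<otimes> (f \<oplus>\<^bsub>RG\<^esub> g) (inv\<^bsub>G\<^esub> y \<otimes>\<^bsub>G\<^esub> x))"
      using T x f g h by (intro mult_RG_apply add_RG_closed) auto
    also have "\<dots> = (\<Oplus>y\<in>?T. h y \<otimes> f (inv\<^bsub>G\<^esub> y \<otimes>\<^bsub>G\<^esub> x))
        \<oplus> (\<Oplus>y\<in>?T. h y \<otimes> g (inv\<^bsub>G\<^esub> y \<otimes>\<^bsub>G\<^esub> x))"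
      using fc gc hc by (simp add: add_RG R.r_distr R.finsum_addf Pi_def)
    also have "\<dots> = (h \<otimes>\<^bsub>RG\<^esub> f \<oplus>\<^bsub>RG\<^esub> h \<otimes>\<^bsub>RG\<^esub> g) x"
      unfolding add_RG using T x f g h by (subst (1 2) mult_RG_apply[where T = ?T]) auto
    finally show "(h \<otimes>\<^bsub>RG\<^esub> (f \<oplus>\<^bsub>RG\<^esub> g)) x = (h \<otimes>\<^bsub>RG\<^esub> f \<oplus>\<^bsub>RG\<^esub> h \<otimes>\<^bsub>RG\<^esub> g) x" .
  qed (use f g h mult_RG_closed add_RG_closed in auto)
qed (auto intro: mult_RG_closed add_RG_closed simp: mult_RG_assoc)

end

sublocale group_algebra \<subseteq> RG: ring "group_ring R G"
  by (rule ring_RG)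

context group_algebra
begin

lemma single_mult_single:
  assumes "r \<in> carrier R" "s \<in> carrier R" "y \<in> carrier G" "z \<in> carrier G"
  shows "single r y \<otimes>\<^bsub>RG\<^esub> single s z = single (r \<otimes> s) (y \<otimes>\<^bsub>G\<^esub> z)"
proof (rule RG_eqI)
  fix x assume x: "x \<in> carrier G"
  have "inv\<^bsub>G\<^esub> y \<otimes>\<^bsub>G\<^esub> x = z \<longleftrightarrow> x = y \<otimes>\<^bsub>G\<^esub> z"
    using assms(3,4) x by (metis G.inv_closed G.inv_solve_left)
  then show "(single r y \<otimes>\<^bsub>RG\<^esub> single s z) x = single (r \<otimes> s) (y \<otimes>\<^bsub>G\<^esub> z) x"
    using assms unfolding single_mult_apply[OF single_closed[OF assms(2,4)] assms(1,3) x]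
    by (simp add: single_def)
qed (use assms single_closed in auto)

lemma single_add: 
  "r \<in> carrier R \<Longrightarrow> s \<in> carrier R \<Longrightarrow> single r y \<oplus>\<^bsub>RG\<^esub> single s y = single (r \<oplus> s) y"
  by (auto simp: add_RG single_def)

lemma ring_hom_scalar: "ring_hom_ring R RG (\<lambda>r. single r \<one>\<^bsub>G\<^esub>)"
  by (intro ring_hom_ringI R.ring_axioms RG.ring_axioms)
    (auto simp: single_closed single_mult_single single_add one_RG)

section \<open>The augmentation homomorphism and its kernel\<close>

lemma aug_eq:
  assumes "f \<in> carrier RG" "finite T" "supp f \<subseteq> T"
  shows "aug f = finsum R f T"
  unfolding aug_def using assms RG_closed[OF assms(1)]
  by (intro R.add.finprod_mono_neutral_cong_left) (auto simp: supp_def)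

lemma aug_closed: "f \<in> carrier RG \<Longrightarrow> aug f \<in> carrier R"
  unfolding aug_def using RG_closed by auto

lemma aug_single:
  assumes "r \<in> carrier R" "y \<in> carrier G"
  shows "aug (single r y) = r"
proof -
  have "supp (single r y) \<subseteq> {y}"
    by (auto simp: supp_def single_def)
  then have "aug (single r y) = finsum R (single r y) {y}"
    using assms by (intro aug_eq single_closed) auto
  then show ?thesis
    using assms by (simp add: single_def)
qed

lemma aug_add:
  assumes f: "f \<in> carrier RG" and g: "g \<in> carrier RG"
  shows "aug (f \<oplus>\<^bsub>RG\<^esub> g) = aug f \<oplus> aug g"
proof -
  let ?T = "supp f \<union> supp g"
  have T: "finite ?T" "supp (f \<oplus>\<^bsub>RG\<^esub> g) \<subseteq> ?T"
    using RG_supp[OF f] RG_supp[OF g] by (auto simp: supp_def add_RG)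
  have "aug (f \<oplus>\<^bsub>RG\<^esub> g) = (\<Oplus>x\<in>?T. f x \<oplus> g x)"
    using aug_eq[OF add_RG_closed[OF f g] T] by (simp add: add_RG)
  also have "\<dots> = finsum R f ?T \<oplus> finsum R g ?T"
    using RG_closed[OF f] RG_closed[OF g] by (intro R.finsum_addf) auto
  also have "\<dots> = aug f \<oplus> aug g"
    using aug_eq[OF f T(1)] aug_eq[OF g T(1)] by simp
  finally show ?thesis .
qed

text \<open>After exchanging the sums, the inner sum of \<open>g(y^-1 x)\<close> over
  \<open>T\<close> runs over a translate of \<open>T\<close> containing the support of
  \<open>g\<close>, so it is \<open>aug g\<close> for every \<open>y\<close>.\<close>

lemma aug_mult:
  assumes f: "f \<in> carrier RG" and g: "g \<in> carrier RG"
  shows "aug (f \<otimes>\<^bsub>RG\<^esub> g) = aug f \<otimes> aug g"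
proof -
  define T where T: "T = (\<lambda>(y, z). y \<otimes>\<^bsub>G\<^esub> z) ` (supp f \<times> supp g)"
  note F = RG_supp[OF f]
  note fc = RG_closed[OF f] and gc = RG_closed[OF g]
  have TG: "finite T" "T \<subseteq> carrier G"
    using RG_supp[OF f] RG_supp[OF g] unfolding T by auto
  have inner: "(\<Oplus>x\<in>T. g (inv\<^bsub>G\<^esub> y \<otimes>\<^bsub>G\<^esub> x)) = aug g" if y: "y \<in> supp f" for y
  proof -
    note tr = translate_product_set[OF f g y T]
    have "aug g = finsum R g ((\<lambda>z. inv\<^bsub>G\<^esub> y \<otimes>\<^bsub>G\<^esub> z) ` T)"
      using tr by (intro aug_eq[OF g]) auto
    also have "\<dots> = (\<Oplus>x\<in>T. g (inv\<^bsub>G\<^esub> y \<otimes>\<^bsub>G\<^esub> x))"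
      using tr(3) gc by (intro R.finsum_reindex) auto
    finally show ?thesis by simp
  qed
  have "aug (f \<otimes>\<^bsub>RG\<^esub> g) = (\<Oplus>x\<in>T. (f \<otimes>\<^bsub>RG\<^esub> g) x)"
    using f g TG mult_RG_supp[of f g] by (intro aug_eq) (auto simp: T)
  also have "\<dots> = (\<Oplus>x\<in>T. \<Oplus>y\<in>supp f. f y \<otimes> g (inv\<^bsub>G\<^esub> y \<otimes>\<^bsub>G\<^esub> x))"
    using f g F TG fc gc by (intro R.finsum_cong' refl mult_RG_apply) auto
  also have "\<dots> = (\<Oplus>y\<in>supp f. \<Oplus>x\<in>T. f y \<otimes> g (inv\<^bsub>G\<^esub> y \<otimes>\<^bsub>G\<^esub> x))"
    using F TG fc gc by (intro R.finsum_swap) auto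
  also have "\<dots> = (\<Oplus>y\<in>supp f. f y \<otimes> aug g)"
    using F TG fc gc aug_closed[OF g]
    by (intro R.finsum_cong' refl) (auto simp: R.finsum_rdistr[symmetric] inner Pi_def)
  also have "\<dots> = aug f \<otimes> aug g"
    unfolding aug_def[of f] using F fc aug_closed[OF g] by (intro R.finsum_ldistr[symmetric]) auto
  finally show ?thesis .
qed

lemma ring_hom_aug: "ring_hom_ring RG R aug"
  by (intro ring_hom_ringI R.ring_axioms RG.ring_axioms)
    (auto simp: aug_closed aug_mult aug_add one_RG aug_single)

lemma finsum_RG_apply:
  assumes "finite A" "F \<in> A \<rightarrow> carrier RG"
  shows "finsum RG F A x = (\<Oplus>i\<in>A. F i x)"
  using assms
proof (induction A)
  case (insert i A)
  then show ?case
    by (auto simp: RG.finsum_insert R.finsum_insert add_RG RG_closed Pi_def)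
qed (simp add: zero_RG)

lemma add_pow_RG_apply: "f \<in> carrier RG \<Longrightarrow> add_pow RG (n::nat) f x = add_pow R n (f x)"
  by (induction n) (simp_all add: zero_RG add_RG)

lemma RG_eq_finsum:
  assumes f: "f \<in> carrier RG"
  shows "f = (\<Oplus>\<^bsub>RG\<^esub>y\<in>supp f. single (f y) y)"
proof
  fix x
  note F = RG_supp[OF f]
  note fc = RG_closed[OF f]
  have "(\<Oplus>\<^bsub>RG\<^esub>y\<in>supp f. single (f y) y) x = (\<Oplus>y\<in>supp f. if x = y then f y else \<zero>)"
    using F fc single_closed by (subst finsum_RG_apply) (auto simp: single_def Pi_def)
  also have "\<dots> = f x"
  proof (cases "x \<in> supp f")
    case True
    then show ?thesis
      using F fc by (intro R.finsum_singleton) auto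
  next
    case False
    then have "(\<Oplus>y\<in>supp f. if x = y then f y else \<zero>) = \<zero>"
      by (intro R.add.finprod_one_eqI) auto
    then show ?thesis
      using False by (simp add: not_supp)
  qed
  finally show "f x = (\<Oplus>\<^bsub>RG\<^esub>y\<in>supp f. single (f y) y) x" by simp
qed

text \<open>Writing each \<open>y\<close> as \<open>(y - 1) + 1\<close> splits \<open>f\<close> into
  the displayed sum and a scalar part whose value is \<open>aug f = 0\<close>. So the elements
  \<open>y - 1\<close> span the augmentation ideal.\<close>

lemma aug_zero_eq_finsum:
  assumes f: "f \<in> carrier RG" and aug: "aug f = \<zero>"
  shows "f = (\<Oplus>\<^bsub>RG\<^esub>y\<in>supp f. single (f y) \<one>\<^bsub>G\<^esub> \<otimes>\<^bsub>RG\<^esub> (single \<one> y \<ominus>\<^bsub>RG\<^esub> \<one>\<^bsub>RG\<^esub>))"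
proof -
  note F = RG_supp[OF f]
  note fc = RG_closed[OF f]
  have c: "single (f y) \<one>\<^bsub>G\<^esub> \<in> carrier RG" "single (f y) y \<in> carrier RG"
      "single \<one> y \<in> carrier RG" if "y \<in> supp f" for y
    using that F fc single_closed by auto
  have scalars: "(\<Oplus>\<^bsub>RG\<^esub>y\<in>supp f. single (f y) \<one>\<^bsub>G\<^esub>) = \<zero>\<^bsub>RG\<^esub>"
  proof
    fix x
    have "(\<Oplus>\<^bsub>RG\<^esub>y\<in>supp f. single (f y) \<one>\<^bsub>G\<^esub>) x = (\<Oplus>y\<in>supp f. single (f y) \<one>\<^bsub>G\<^esub> x)"
      using F c by (intro finsum_RG_apply) auto
    also have "\<dots> = \<zero>"
      using aug unfolding aug_def by (cases "x = \<one>\<^bsub>G\<^esub>") (simp_all add: single_def)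
    finally show "(\<Oplus>\<^bsub>RG\<^esub>y\<in>supp f. single (f y) \<one>\<^bsub>G\<^esub>) x = \<zero>\<^bsub>RG\<^esub> x"
      by (simp add: zero_RG)
  qed
  let ?S = "\<Oplus>\<^bsub>RG\<^esub>y\<in>supp f. single (f y) \<one>\<^bsub>G\<^esub> \<otimes>\<^bsub>RG\<^esub> (single \<one> y \<ominus>\<^bsub>RG\<^esub> \<one>\<^bsub>RG\<^esub>)"
  have S: "?S \<in> carrier RG"
    using c by (intro RG.finsum_closed) auto
  have "f = (\<Oplus>\<^bsub>RG\<^esub>y\<in>supp f. single (f y) y)"
    by (rule RG_eq_finsum[OF f])
  also have "\<dots> = (\<Oplus>\<^bsub>RG\<^esub>y\<in>supp f.
      single (f y) \<one>\<^bsub>G\<^esub> \<otimes>\<^bsub>RG\<^esub> (single \<one> y \<ominus>\<^bsub>RG\<^esub> \<one>\<^bsub>RG\<^esub>) \<oplus>\<^bsub>RG\<^esub> single (f y) \<one>\<^bsub>G\<^esub>)"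
  proof (intro RG.finsum_cong' refl)
    fix y assume y: "y \<in> supp f"
    have "single (f y) y = single (f y) \<one>\<^bsub>G\<^esub> \<otimes>\<^bsub>RG\<^esub> single \<one> y"
      using y F fc by (subst single_mult_single) auto
    then show "single (f y) y = single (f y) \<one>\<^bsub>G\<^esub> \<otimes>\<^bsub>RG\<^esub> (single \<one> y \<ominus>\<^bsub>RG\<^esub> \<one>\<^bsub>RG\<^esub>)
        \<oplus>\<^bsub>RG\<^esub> single (f y) \<one>\<^bsub>G\<^esub>"
      using c[OF y] by (simp add: RG.minus_eq RG.r_distr RG.r_minus RG.a_assoc RG.l_neg)
  qed (use c in auto)
  also have "\<dots> = ?S \<oplus>\<^bsub>RG\<^esub> (\<Oplus>\<^bsub>RG\<^esub>y\<in>supp f. single (f y) \<one>\<^bsub>G\<^esub>)"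
    using c by (intro RG.finsum_addf) auto
  also have "\<dots> = ?S"
    unfolding scalars using S by simp
  finally show ?thesis .
qed

end

section \<open>GUNC group rings\<close>

context group_algebra
begin

abbreviation scalar :: "'a \<Rightarrow> 'g \<Rightarrow> 'a" where
  "scalar r \<equiv> single r \<one>\<^bsub>G\<^esub>"

lemma aug_scalar: "r \<in> carrier R \<Longrightarrow> aug (scalar r) = r"
  by (simp add: aug_single)

section \<open>Transfer of nilpotents, idempotents and units between \<open>R\<close> and
  \<open>RG\<close>\<close>

lemma scalar_nilpotents: "r \<in> nilpotents R \<Longrightarrow> scalar r \<in> nilpotents RG"
proof -
  interpret s: ring_hom_ring R RG "\<lambda>r. scalar r" by (rule ring_hom_scalar)
  assume "r \<in> nilpotents R"
  then obtain n :: nat where n: "r \<in> carrier R" "r [^] n = \<zero>"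
    by (rule nilpotentsE)
  then have "scalar r [^]\<^bsub>RG\<^esub> n = \<zero>\<^bsub>RG\<^esub>"
    using s.hom_nat_pow[of r n] by simp
  then show ?thesis
    using n(1) by (intro nilpotentsI) simp_all
qed

lemma scalar_idempotents: "e \<in> idempotents R \<Longrightarrow> scalar e \<in> idempotents RG"
  using single_mult_single[of e e "\<one>\<^bsub>G\<^esub>" "\<one>\<^bsub>G\<^esub>"] single_closed[of e "\<one>\<^bsub>G\<^esub>"]
  unfolding idempotents_def by simp

lemma aug_nilpotents: "f \<in> nilpotents RG \<Longrightarrow> aug f \<in> nilpotents R"
proof -
  interpret a: ring_hom_ring RG R aug by (rule ring_hom_aug)
  assume "f \<in> nilpotents RG"
  then obtain n :: nat where n: "f \<in> carrier RG" "f [^]\<^bsub>RG\<^esub> n = \<zero>\<^bsub>RG\<^esub>"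
    by (rule nilpotentsE)
  then have "aug f [^] n = \<zero>"
    using a.hom_nat_pow[of f n] by simp
  then show ?thesis
    using n(1) by (intro nilpotentsI) simp_all
qed

lemma aug_idempotents:
  assumes "f \<in> idempotents RG" shows "aug f \<in> idempotents R"
  using idempotentsD[OF assms] aug_mult[of f f] aug_closed[of f] unfolding idempotents_def by simp

lemma aug_minus:
  "f \<in> carrier RG \<Longrightarrow> g \<in> carrier RG \<Longrightarrow> aug (f \<ominus>\<^bsub>RG\<^esub> g) = aug f \<ominus> aug g"
proof -
  interpret a: ring_hom_ring RG R aug by (rule ring_hom_aug)
  show "f \<in> carrier RG \<Longrightarrow> g \<in> carrier RG \<Longrightarrow> ?thesis"
    by (simp add: RG.minus_eq R.minus_eq)
qed

lemma scalar_minus: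
  "r \<in> carrier R \<Longrightarrow> s \<in> carrier R \<Longrightarrow> scalar (r \<ominus> s) = scalar r \<ominus>\<^bsub>RG\<^esub> scalar s"
proof -
  interpret s: ring_hom_ring R RG "\<lambda>r. scalar r" by (rule ring_hom_scalar)
  show "r \<in> carrier R \<Longrightarrow> s \<in> carrier R \<Longrightarrow> ?thesis"
    by (simp add: RG.minus_eq R.minus_eq)
qed

lemma aug_Units: "f \<in> Units RG \<Longrightarrow> aug f \<in> Units R"
proof -
  assume "f \<in> Units RG"
  then obtain g where g: "f \<in> carrier RG" "g \<in> carrier RG" "g \<otimes>\<^bsub>RG\<^esub> f = \<one>\<^bsub>RG\<^esub>"
      "f \<otimes>\<^bsub>RG\<^esub> g = \<one>\<^bsub>RG\<^esub>"
    unfolding Units_def by blast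
  then have "aug g \<otimes> aug f = \<one>" "aug f \<otimes> aug g = \<one>"
    using aug_mult by (metis one_RG aug_single R.one_closed G.one_closed)+
  then show ?thesis
    unfolding Units_def using g aug_closed by blast
qed

lemma central_scalar:
  assumes e: "e \<in> carrier R" "\<And>r. r \<in> carrier R \<Longrightarrow> e \<otimes> r = r \<otimes> e" and f: "f \<in> carrier RG"
  shows "scalar e \<otimes>\<^bsub>RG\<^esub> f = f \<otimes>\<^bsub>RG\<^esub> scalar e"
  using assms single_closed RG_closed[OF f]
  by (intro RG_eqI) (auto simp: single_mult_apply mult_single_apply)

theorem aug_zero_nilpotent:
  assumes p: "Factorial_Ring.prime p" and pG: "p_group p G" and lf: "locally_finite_group G"
    and nil: "add_pow R p \<one> \<in> nilpotents R"
    and f: "f \<in> carrier RG" and aug: "aug f = \<zero>"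
  shows "f \<in> nilpotents RG"
proof -
  obtain k :: nat where "add_pow R p \<one> [^] k = \<zero>"
    using nil by (rule nilpotentsE)
  then have pk: "add_pow R (p ^ k) \<one> = \<zero>"
    by (simp add: R.natmult_one_pow)
  have pkRG: "add_pow RG (p ^ k) \<one>\<^bsub>RG\<^esub> = \<zero>\<^bsub>RG\<^esub>"
  proof
    fix x
    have "add_pow RG (p ^ k) \<one>\<^bsub>RG\<^esub> x = add_pow R (p ^ k) (\<one>\<^bsub>RG\<^esub> x)"
      by (rule add_pow_RG_apply) simp
    then show "add_pow RG (p ^ k) \<one>\<^bsub>RG\<^esub> x = \<zero>\<^bsub>RG\<^esub> x"
      using pk by (simp add: one_RG single_def zero_RG)
  qed
  \<comment> \<open>Local finiteness makes the subgroup generated by the support finite, and it is a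
    \<open>p\<close>-group because all element orders are powers of \<open>p\<close>.\<close>
  define K where "K = generate G (supp f)"
  have subK: "subgroup K G"
    unfolding K_def using RG_supp(2)[OF f] by (rule G.generate_is_subgroup)
  have finK: "finite K"
    using lf RG_supp[OF f] unfolding K_def locally_finite_group_def by blast
  have KG: "K \<subseteq> carrier G"
    using subK by (rule subgroup.subset)
  let ?H = "G\<lparr>carrier := K\<rparr>"
  interpret H: group ?H
    using G.subgroup_imp_group[OF subK] .
  have "\<exists>n. order ?H = p ^ n"
  proof (rule H.order_eq_prime_power[OF _ p])
    show "finite (carrier ?H)" using finK by simp
    show "\<exists>n. x [^]\<^bsub>?H\<^esub> (p ^ n) = \<one>\<^bsub>?H\<^esub>" if "x \<in> carrier ?H" for x
    proof -
      have xG: "x \<in> carrier G" using that KG by auto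
      then obtain n where "G.ord x = p ^ n"
        using pG unfolding p_group_def by blast
      then have "x [^]\<^bsub>G\<^esub> (p ^ n) = \<one>\<^bsub>G\<^esub>"
        using G.pow_ord_eq_1[OF xG] by simp
      then show ?thesis
        by (auto simp: G.nat_pow_consistent[symmetric])
    qed
  qed
  then obtain n where n: "order ?H = p ^ n" by blast
  obtain j where j: "\<one>\<^bsub>RG\<^esub> \<in> augmentation_annihilator RG (single \<one> ` carrier ?H) j"
    using RG.one_in_augmentation_annihilator[OF H.is_group p n pkRG, of "single \<one>"]
      KG single_closed single_mult_single one_RG by (auto simp: subset_iff)
  show ?thesis
  proof (rule RG.nilpotent_of_mem_augmentation_annihilator)
    show "single \<one> ` carrier ?H \<subseteq> carrier RG"
      using KG single_closed by auto
    show "f = (\<Oplus>\<^bsub>RG\<^esub>y\<in>supp f. scalar (f y) \<otimes>\<^bsub>RG\<^esub> (single \<one> y \<ominus>\<^bsub>RG\<^esub> \<one>\<^bsub>RG\<^esub>))"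
      using f aug by (rule aug_zero_eq_finsum)
    show "single \<one> y \<in> single \<one> ` carrier ?H" if "y \<in> supp f" for y
      using that unfolding K_def by (auto intro: generate.incl)
    \<comment> \<open>Scalars commute with group elements even when \<open>R\<close> is not
      commutative.\<close>
    show "v \<otimes>\<^bsub>RG\<^esub> scalar (f y) = scalar (f y) \<otimes>\<^bsub>RG\<^esub> v"
      if "v \<in> single \<one> ` carrier ?H" for y v
      using that KG RG_closed[OF f] by (auto simp: single_mult_single subset_iff)
  qed (use RG_supp[OF f] RG_closed[OF f] single_closed j in auto)
qed

text \<open>Nilpotency and invertibility are both detected by the augmentation because its kernel is
  nil. The idempotent for \<open>f\<close> is the scalar idempotent belonging to
  \<open>aug f\<close>; uniqueness comes from its centrality.\<close>

lemma GUNC_RG_of_GUNC: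
  assumes p: "Factorial_Ring.prime p" and pG: "p_group p G" and lf: "locally_finite_group G"
    and nil: "add_pow R p \<one> \<in> nilpotents R" and gunc: "GUNC R"
  shows "GUNC RG"
  unfolding GUNC_def
proof
  note ker_nil = aug_zero_nilpotent[OF p pG lf nil]
  interpret a: ring_hom_ring RG R aug by (rule ring_hom_aug)
  \<comment> \<open>Some power of \<open>f\<close> has augmentation zero and is therefore
    nilpotent.\<close>
  have nil_lift: "f \<in> nilpotents RG" if f: "f \<in> carrier RG" "aug f \<in> nilpotents R" for f
  proof -
    obtain n :: nat where "aug f [^] n = \<zero>"
      using f(2) by (rule nilpotentsE)
    then have "f [^]\<^bsub>RG\<^esub> n \<in> nilpotents RG"
      using f(1) a.hom_nat_pow[of f n] by (intro ker_nil) auto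
    then show ?thesis
      using RG.nilpotents_of_pow f(1) by blast
  qed
  have unit_lift: "f \<in> Units RG" if f: "f \<in> carrier RG" "aug f = \<one>" for f
  proof -
    have "\<one>\<^bsub>RG\<^esub> \<ominus>\<^bsub>RG\<^esub> f \<in> nilpotents RG"
      using f by (intro ker_nil) (auto simp: aug_minus R.minus_eq R.r_neg)
    then have "\<one>\<^bsub>RG\<^esub> \<ominus>\<^bsub>RG\<^esub> (\<one>\<^bsub>RG\<^esub> \<ominus>\<^bsub>RG\<^esub> f) \<in> Units RG"
      by (rule RG.one_minus_nilpotent_Units)
    moreover have "\<one>\<^bsub>RG\<^esub> \<ominus>\<^bsub>RG\<^esub> (\<one>\<^bsub>RG\<^esub> \<ominus>\<^bsub>RG\<^esub> f) = f"
      using f(1) by (simp add: RG.minus_eq RG.minus_add RG.r_neg2 RG.r_neg1)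
    ultimately show ?thesis by simp
  qed
  fix f assume "f \<in> carrier RG - Units RG"
  then have f: "f \<in> carrier RG" "f \<notin> Units RG" by auto
  have "aug f \<notin> Units R"
  proof
    assume "aug f \<in> Units R"
    then obtain r where r: "r \<in> carrier R" "r \<otimes> aug f = \<one>" "aug f \<otimes> r = \<one>"
      unfolding Units_def by blast
    have sr: "scalar r \<in> carrier RG"
      using r(1) by (simp add: single_closed)
    \<comment> \<open>Both products have augmentation 1. The first yields a left inverse of
      \<open>f\<close> and the second a right inverse, which then coincide.\<close>
    have L: "scalar r \<otimes>\<^bsub>RG\<^esub> f \<in> Units RG" and R: "f \<otimes>\<^bsub>RG\<^esub> scalar r \<in> Units RG"
      using f(1) sr r by (auto intro!: unit_lift simp: aug_scalar)
    obtain u where u: "u \<in> carrier RG" "u \<otimes>\<^bsub>RG\<^esub> (scalar r \<otimes>\<^bsub>RG\<^esub> f) = \<one>\<^bsub>RG\<^esub>"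
      using L unfolding Units_def by blast
    obtain v where v: "v \<in> carrier RG" "(f \<otimes>\<^bsub>RG\<^esub> scalar r) \<otimes>\<^bsub>RG\<^esub> v = \<one>\<^bsub>RG\<^esub>"
      using R unfolding Units_def by blast
    have "(u \<otimes>\<^bsub>RG\<^esub> scalar r) \<otimes>\<^bsub>RG\<^esub> f = \<one>\<^bsub>RG\<^esub>" "f \<otimes>\<^bsub>RG\<^esub> (scalar r \<otimes>\<^bsub>RG\<^esub> v) = \<one>\<^bsub>RG\<^esub>"
      using u v sr f(1) by (simp_all add: RG.m_assoc)
    then have "f \<in> Units RG"
      using u(1) v(1) sr f(1) RG.inv_unique[of "u \<otimes>\<^bsub>RG\<^esub> scalar r" f "scalar r \<otimes>\<^bsub>RG\<^esub> v"]
      unfolding Units_def by auto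
    then show False using f(2) by blast
  qed
  then have unc: "uniquely_nil_clean R (aug f)"
    using gunc f(1) aug_closed unfolding GUNC_def by blast
  then obtain e where e: "e \<in> idempotents R" "aug f \<ominus> e \<in> nilpotents R"
    unfolding uniquely_nil_clean_def by blast
  have eR: "e \<in> carrier R" and eRG: "scalar e \<in> carrier RG"
    using idempotentsD[OF e(1)] by (auto simp: single_closed)
  show "uniquely_nil_clean RG f"
    unfolding uniquely_nil_clean_def
  proof (intro ex1I conjI)
    show "scalar e \<in> idempotents RG"
      using e(1) by (rule scalar_idempotents)
    show "f \<ominus>\<^bsub>RG\<^esub> scalar e \<in> nilpotents RG"
      using e(2) f(1) eR eRG by (intro nil_lift) (auto simp: aug_minus aug_scalar)
    fix g assume g: "g \<in> idempotents RG \<and> f \<ominus>\<^bsub>RG\<^esub> g \<in> nilpotents RG"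
    have gRG: "g \<in> carrier RG"
      using idempotentsD(1)[OF conjunct1[OF g]] .
    have "aug f \<ominus> aug g \<in> nilpotents R"
      using aug_nilpotents[of "f \<ominus>\<^bsub>RG\<^esub> g"] g f(1) gRG by (simp add: aug_minus)
    then have "aug g = e"
      using unc e g aug_idempotents unfolding uniquely_nil_clean_def by blast
    then have "g \<ominus>\<^bsub>RG\<^esub> scalar e \<in> nilpotents RG"
      using gRG eR eRG by (intro ker_nil) (auto simp: aug_minus aug_scalar R.minus_eq R.r_neg)
    moreover have "scalar e \<otimes>\<^bsub>RG\<^esub> g = g \<otimes>\<^bsub>RG\<^esub> scalar e"
      using eR R.GUNC_idempotent_central[OF gunc e(1)] gRG by (rule central_scalar)
    ultimately show "g = scalar e"
      by (intro RG.central_idempotent_unique[OF scalar_idempotents[OF e(1)] conjunct1[OF g]])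
  qed
qed

text \<open>\<open>R\<close> is a retract of \<open>RG\<close>, since \<open>aug\<close> undoes
  \<open>scalar\<close>. The augmentation carries a decomposition of \<open>scalar a\<close> to one
  of \<open>a\<close>, and two decompositions of \<open>a\<close> become decompositions of
  \<open>scalar a\<close>, where uniqueness applies.\<close>

lemma GUNC_of_GUNC_RG:
  assumes gunc: "GUNC RG"
  shows "GUNC R"
  unfolding GUNC_def
proof
  interpret s: ring_hom_ring R RG "\<lambda>r. scalar r" by (rule ring_hom_scalar)
  fix a assume "a \<in> carrier R - Units R"
  then have a: "a \<in> carrier R" "a \<notin> Units R" by auto
  have sa: "scalar a \<in> carrier RG"
    using a(1) by (simp add: single_closed)
  have "scalar a \<notin> Units RG"
    using aug_Units[of "scalar a"] a by (auto simp: aug_scalar)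
  then have unc: "uniquely_nil_clean RG (scalar a)"
    using gunc sa unfolding GUNC_def by blast
  then obtain e where e: "e \<in> idempotents RG" "scalar a \<ominus>\<^bsub>RG\<^esub> e \<in> nilpotents RG"
    unfolding uniquely_nil_clean_def by blast
  show "uniquely_nil_clean R a"
    unfolding uniquely_nil_clean_def
  proof (intro ex_ex1I exI conjI)
    show "aug e \<in> idempotents R"
      using e(1) by (rule aug_idempotents)
    show "a \<ominus> aug e \<in> nilpotents R"
      using aug_nilpotents[OF e(2)] idempotentsD(1)[OF e(1)] sa a(1)
      by (simp add: aug_minus aug_scalar)
    fix b c
    assume b: "b \<in> idempotents R \<and> a \<ominus> b \<in> nilpotents R"
      and c: "c \<in> idempotents R \<and> a \<ominus> c \<in> nilpotents R"
    have bc: "b \<in> carrier R" "c \<in> carrier R"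
      using idempotentsD(1)[OF conjunct1[OF b]] idempotentsD(1)[OF conjunct1[OF c]] .
    have "scalar a \<ominus>\<^bsub>RG\<^esub> scalar b \<in> nilpotents RG" "scalar a \<ominus>\<^bsub>RG\<^esub> scalar c \<in> nilpotents RG"
      using b c a(1) bc scalar_nilpotents by (simp_all flip: scalar_minus)
    moreover have "scalar b \<in> idempotents RG" "scalar c \<in> idempotents RG"
      using b c scalar_idempotents by auto
    ultimately have "scalar b = scalar c"
      using unc unfolding uniquely_nil_clean_def by blast
    then show "b = c"
      using bc aug_scalar by metis
  qed
qed

text \<open>As \<open>1 - g\<close> has augmentation zero and
  \<open>\<one> \<noteq> \<zero>\<close>, it is a non-unit, so \<open>1 - g - e\<close> is nilpotent
  for some idempotent \<open>e\<close>, which is central. Multiplying by \<open>e\<close> gives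
  \<open>- g e\<close>, so \<open>g e\<close> is nilpotent. Multiplying by the inverse of
  \<open>g\<close>, which commutes with \<open>g e\<close>, shows that \<open>e\<close> is
  nilpotent, hence zero.\<close>

lemma one_minus_group_element_nilpotent:
  assumes gunc: "GUNC RG" and g: "g \<in> carrier G"
    and nontriv: "\<one> \<noteq> \<zero>"
  shows "\<one>\<^bsub>RG\<^esub> \<ominus>\<^bsub>RG\<^esub> single \<one> g \<in> nilpotents RG"
proof -
  let ?g = "single \<one> g"
  have gR: "?g \<in> carrier RG"
    using g by (simp add: single_closed)
  have aug0: "aug (\<one>\<^bsub>RG\<^esub> \<ominus>\<^bsub>RG\<^esub> ?g) = \<zero>"
    using gR g by (simp add: aug_minus one_RG aug_single single_closed R.minus_eq R.r_neg)
  have "\<one>\<^bsub>RG\<^esub> \<ominus>\<^bsub>RG\<^esub> ?g \<notin> Units RG"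
    using aug_Units[of "\<one>\<^bsub>RG\<^esub> \<ominus>\<^bsub>RG\<^esub> ?g"] aug0 nontriv by (auto simp: Units_def)
  then obtain e where e: "e \<in> idempotents RG" "(\<one>\<^bsub>RG\<^esub> \<ominus>\<^bsub>RG\<^esub> ?g) \<ominus>\<^bsub>RG\<^esub> e \<in> nilpotents RG"
    using gunc gR unfolding GUNC_def uniquely_nil_clean_def by blast
  have ec: "e \<in> carrier RG" "e \<otimes>\<^bsub>RG\<^esub> e = e"
    using idempotentsD[OF e(1)] by auto
  note central = RG.GUNC_idempotent_central[OF gunc e(1)]
  let ?n = "(\<one>\<^bsub>RG\<^esub> \<ominus>\<^bsub>RG\<^esub> ?g) \<ominus>\<^bsub>RG\<^esub> e"
  have n: "?n \<in> carrier RG"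
    using gR ec by simp
  have "?n \<otimes>\<^bsub>RG\<^esub> e \<in> nilpotents RG"
    using e(2) ec(1) by (rule RG.nilpotents_mult_commute) (simp add: central[OF n])
  moreover have "?n \<otimes>\<^bsub>RG\<^esub> e = \<ominus>\<^bsub>RG\<^esub> (?g \<otimes>\<^bsub>RG\<^esub> e)"
    using gR ec by (simp add: RG.minus_eq RG.l_distr RG.l_minus RG.a_ac RG.r_neg RG.r_neg1 RG.r_neg2)
  ultimately have "\<ominus>\<^bsub>RG\<^esub> (?g \<otimes>\<^bsub>RG\<^esub> e) \<in> nilpotents RG"
    by simp
  then have "?g \<otimes>\<^bsub>RG\<^esub> e \<in> nilpotents RG"
    using RG.nilpotents_uminus gR ec(1) by fastforce
  moreover define i where "i = single \<one> (inv\<^bsub>G\<^esub> g)"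
  have i: "i \<in> carrier RG" "i \<otimes>\<^bsub>RG\<^esub> ?g = \<one>\<^bsub>RG\<^esub>" "?g \<otimes>\<^bsub>RG\<^esub> i = \<one>\<^bsub>RG\<^esub>"
    using g by (simp_all add: i_def single_closed single_mult_single one_RG)
  have "?g \<otimes>\<^bsub>RG\<^esub> e \<otimes>\<^bsub>RG\<^esub> i = i \<otimes>\<^bsub>RG\<^esub> (?g \<otimes>\<^bsub>RG\<^esub> e)"
    "?g \<otimes>\<^bsub>RG\<^esub> e \<otimes>\<^bsub>RG\<^esub> i = e"
    using i gR ec central by (metis RG.m_assoc RG.l_one RG.r_one)+
  ultimately have "e \<in> nilpotents RG"
    using RG.nilpotents_mult_commute[of "?g \<otimes>\<^bsub>RG\<^esub> e" i] i(1) by simp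
  then have "e = \<zero>\<^bsub>RG\<^esub>"
    using e(1) RG.idempotent_nilpotent_eq_zero by blast
  then show ?thesis
    using e(2) gR by (simp add: RG.minus_eq)
qed

lemma prime_nilpotent_of_GUNC_RG:
  assumes p: "Factorial_Ring.prime p" and pG: "p_group p G" and nontriv: "carrier G \<noteq> {\<one>\<^bsub>G\<^esub>}"
    and gunc: "GUNC RG"
  shows "add_pow R p \<one> \<in> nilpotents R"
proof (cases "\<one> = \<zero>")
  case True
  then have "add_pow R p \<one> = \<zero>"
    by simp
  then show ?thesis
    by (intro nilpotentsI[of _ _ 1]) simp_all
next
  case False
  obtain g where g: "g \<in> carrier G" "g \<noteq> \<one>\<^bsub>G\<^esub>"
    using nontriv G.one_closed by blast
  obtain l where l: "G.ord g = p ^ l"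
    using pG g(1) unfolding p_group_def by blast
  define q where "q = p ^ l"
  have q1: "q > 1"
    using l g G.ord_eq_1[OF g(1)] prime_gt_0_nat[OF p]
    unfolding q_def by (metis One_nat_def less_one linorder_neqE_nat not_gr_zero power_eq_0_iff)
  have gq: "g [^]\<^bsub>G\<^esub> q = \<one>\<^bsub>G\<^esub>"
    using l G.pow_ord_eq_1[OF g(1)] unfolding q_def by simp
  let ?g = "single \<one> g"
  have gR: "?g \<in> carrier RG"
    using g(1) by (simp add: single_closed)
  have pow: "?g [^]\<^bsub>RG\<^esub> (i::nat) = single \<one> (g [^]\<^bsub>G\<^esub> i)" for i
    by (induction i) (use g(1) in \<open>simp_all add: one_RG single_mult_single\<close>)
  define N where "N = (\<Oplus>\<^bsub>RG\<^esub>j\<in>{..<q}. ?g [^]\<^bsub>RG\<^esub> j)"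
  define P where "P = add_pow RG q \<one>\<^bsub>RG\<^esub>"
  define y where "y = P \<ominus>\<^bsub>RG\<^esub> N"
  have NP: "N \<in> carrier RG" "P \<in> carrier RG"
    using gR unfolding N_def P_def by (auto intro: RG.finsum_closed)
  then have yR: "y \<in> carrier RG"
    unfolding y_def by simp
  obtain s where s: "s \<in> carrier RG" "s \<otimes>\<^bsub>RG\<^esub> ?g = ?g \<otimes>\<^bsub>RG\<^esub> s"
      "y = s \<otimes>\<^bsub>RG\<^esub> (\<one>\<^bsub>RG\<^esub> \<ominus>\<^bsub>RG\<^esub> ?g)"
    using RG.multiple_minus_geometric_sum[OF gR, of q] unfolding y_def P_def N_def by blast
  have comm: "(\<one>\<^bsub>RG\<^esub> \<ominus>\<^bsub>RG\<^esub> ?g) \<otimes>\<^bsub>RG\<^esub> s = s \<otimes>\<^bsub>RG\<^esub> (\<one>\<^bsub>RG\<^esub> \<ominus>\<^bsub>RG\<^esub> ?g)"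
    using s(1,2) gR by (simp add: RG.minus_eq RG.l_distr RG.r_distr RG.l_minus RG.r_minus)
  have "y \<in> nilpotents RG"
    using RG.nilpotents_mult_commute[OF one_minus_group_element_nilpotent[OF gunc g(1) False] s(1) comm]
      comm s(3) by simp
  then obtain m :: nat where m: "y [^]\<^bsub>RG\<^esub> m = \<zero>\<^bsub>RG\<^esub>"
    by (rule nilpotentsE)
  \<comment> \<open>The product telescopes to \<open>1 - g^q\<close>, which is zero. As
    \<open>y\<close> is a multiple of \<open>1 - g\<close>, also \<open>N y = 0\<close>, and so
    \<open>y y = (q - N) y = q y\<close>.\<close>
  have "N \<otimes>\<^bsub>RG\<^esub> (\<one>\<^bsub>RG\<^esub> \<ominus>\<^bsub>RG\<^esub> ?g) = \<zero>\<^bsub>RG\<^esub>"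
    using RG.geometric_sum(2)[OF gR, of q] pow[of q] gq
    unfolding N_def by (simp add: one_RG[symmetric] RG.minus_eq RG.r_neg)
  moreover have "y = (\<one>\<^bsub>RG\<^esub> \<ominus>\<^bsub>RG\<^esub> ?g) \<otimes>\<^bsub>RG\<^esub> s"
    using s(3) comm by simp
  ultimately have Ny: "N \<otimes>\<^bsub>RG\<^esub> y = \<zero>\<^bsub>RG\<^esub>"
    using NP s(1) gR by (simp add: RG.m_assoc[symmetric])
  have yy: "y \<otimes>\<^bsub>RG\<^esub> y = add_pow RG q y"
  proof -
    have "y \<otimes>\<^bsub>RG\<^esub> y = P \<otimes>\<^bsub>RG\<^esub> y \<ominus>\<^bsub>RG\<^esub> N \<otimes>\<^bsub>RG\<^esub> y"
      using NP yR by (subst y_def) (simp add: RG.minus_eq RG.l_distr RG.l_minus)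
    then show ?thesis
      using Ny NP yR unfolding P_def by (simp add: RG.natmult_one_mult[of y] RG.minus_eq)
  qed
  have ypow: "y [^]\<^bsub>RG\<^esub> Suc k = add_pow RG (q ^ k) y" for k
  proof (induction k)
    case (Suc k)
    have "y [^]\<^bsub>RG\<^esub> Suc (Suc k) = add_pow RG (q ^ k) (add_pow RG q y)"
      using Suc yR yy by (simp add: RG.add_pow_ldistr)
    then show ?case
      using yR by (simp add: RG.add.nat_pow_pow mult.commute)
  qed (use yR in simp)
  \<comment> \<open>The formula for powers of \<open>y\<close> covers positive exponents only, hence
    the shift from \<open>m\<close> to \<open>Suc m\<close>.\<close>
  have "y [^]\<^bsub>RG\<^esub> Suc m = \<zero>\<^bsub>RG\<^esub>"
    using m yR by simp
  then have "add_pow RG (q ^ m) y = \<zero>\<^bsub>RG\<^esub>"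
    using ypow by simp
  then have "add_pow R (q ^ m) (y g) = \<zero>"
    using add_pow_RG_apply[OF yR, of "q ^ m" g] by (simp add: zero_RG)
  \<comment> \<open>The powers of \<open>g\<close> with exponent below \<open>q\<close> are distinct
    and \<open>1 < q\<close>, so \<open>N\<close> has coefficient 1 at \<open>g\<close>. The integer
    \<open>P\<close> has coefficient 0 there because \<open>g\<close> is not the identity.\<close>
  moreover have "y g = \<ominus> \<one>"
  proof -
    have "N g = (\<Oplus>j\<in>{..<q}. if 1 = j then \<one> else \<zero>)"
    proof -
      have "N g = (\<Oplus>j\<in>{..<q}. single \<one> (g [^]\<^bsub>G\<^esub> j) g)"
        unfolding N_def pow using g(1) by (intro finsum_RG_apply) (auto simp: single_closed)
      also have "\<dots> = (\<Oplus>j\<in>{..<q}. if 1 = j then \<one> else \<zero>)"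
      proof (intro R.finsum_cong' refl)
        fix j assume "j \<in> {..<q}"
        then have "g [^]\<^bsub>G\<^esub> j = g [^]\<^bsub>G\<^esub> (1::nat) \<longleftrightarrow> j = 1"
          using G.ord_inj[OF g(1)] q1 l unfolding q_def[symmetric] inj_on_def by fastforce
        then show "single \<one> (g [^]\<^bsub>G\<^esub> j) g = (if 1 = j then \<one> else \<zero>)"
          using g(1) by (auto simp: single_def)
      qed auto
      finally show ?thesis .
    qed
    also have "\<dots> = \<one>"
      using q1 by (intro R.finsum_singleton) auto
    finally have "N g = \<one>" .
    moreover have "P g = \<zero>"
    proof -
      have "\<one>\<^bsub>RG\<^esub> g = \<zero>"
        using g(2) by (simp add: one_RG single_def)
      then show ?thesis
        unfolding P_def add_pow_RG_apply[OF RG.one_closed] by simp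
    qed
    moreover have "y \<oplus>\<^bsub>RG\<^esub> N = P"
      using NP unfolding y_def by (simp add: RG.minus_eq RG.a_assoc RG.l_neg)
    then have "y g \<oplus> N g = P g"
      by (auto simp: add_RG)
    ultimately show ?thesis
      using RG_closed[OF yR] R.minus_equality by fastforce
  qed
  ultimately have "add_pow R (q ^ m) (\<ominus> \<one>) = \<zero>"
    by simp
  then have "add_pow R (q ^ m) \<one> = \<zero>"
    using R.natmult_one_mult[of "\<ominus> \<one>" "q ^ m"] by (simp add: R.r_minus)
  \<comment> \<open>Here \<open>q ^ m = p ^ (l * m)\<close>.\<close>
  then have "add_pow R p \<one> [^] (l * m) = \<zero>"
    by (simp add: R.natmult_one_pow q_def power_mult)
  then show ?thesis
    by (intro nilpotentsI) simp_all
qed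

end

text \<open>Nontriviality of \<open>G\<close> supplies the element \<open>g\<close> that forces
  \<open>p\<close> to be nilpotent. For the trivial group \<open>RG\<close> is a copy of
  \<open>R\<close>, and the field with three elements is GUNC although 2 is invertible in
  it.\<close>

theorem proposition3p2:
  fixes R :: "('a, 'm) ring_scheme"
    and G :: "('g, 'n) monoid_scheme"
    and p :: nat
  assumes "ring R"
    and "Factorial_Ring.prime p"
    and "p_group p G"
    and "locally_finite_group G"
    and nontrivial: "carrier G \<noteq> {\<one>\<^bsub>G\<^esub>}"
  shows "GUNC (group_ring R G) \<longleftrightarrow> GUNC R \<and> [p] \<cdot>\<^bsub>R\<^esub> \<one>\<^bsub>R\<^esub> \<in> nilpotents R"
proof -
  have "group G"
    using assms(3) unfolding p_group_def by blast
  then interpret group_algebra R G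
    using assms(1) by (intro group_algebra.intro)
  show ?thesis
    using GUNC_RG_of_GUNC GUNC_of_GUNC_RG prime_nilpotent_of_GUNC_RG assms by blast
qed

end
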